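(* Let $T>0$, let $k\ge 0$ be an integer, and let $a:(0,1)\to\mathbb{R}$ be measurable with $a_0\le a(x)\le a_1$ for some constants $a_0,a_1>0$. Let $(u,p)$ be a solution on $[0,T]$ of the damped wave system $$\partial_t u+\partial_x p+a u=0,\qquad \partial_t p+\partial_x u=0\quad\text{in }(0,1)\times(0,T),\qquad p=0\ \text{ on }\{0,1\}\times(0,T),$$ with finite energy $E^k(0)<\infty$, where $E^k(t)=\frac12\big(\|\partial_t^k u(t)\|^2+\|\partial_t^k p(t)\|^2\big)$. Then $$E^k(t)\le 3\,e^{-\alpha(t-s)}E^k(s),\qquad 0\le s\le t\le T,$$ with decay rate $\alpha=\frac43\,\dfrac{a_0^3}{8a_0^2+4a_0^2a_1+2a_0a_1+a_1^4}$.
   Context: $\|\cdot\|$ is the norm of $L^2(0,1)$. "Solution" means mild solution in the sense of semigroup theory, $(u,p)\in C^0([0,T];L^2(0,1)\times L^2(0,1))$, for initial data $(u_0,p_0)\in L^2(0,1)\times L^2(0,1)$; the underlying generator is $(u,p)\mapsto(-\partial_x p-au,-\partial_x u)$ with domain $H^1(0,1)\times H^1_0(0,1)$. If $(u_0,p_0)\in H^1(0,1)\times H_0^1(0,1)$ the solution is classical, i.e. $(u,p)\in C^1([0,T];L^2\times L^2)\cap C^0([0,T];H^1\times H^1_0)$. For $k\ge1$, finiteness of $E^k(0)$ means that the solution is regular enough that $(\partial_t^k u,\partial_t^k p)$ is itself a mild solution of the same system (equivalently, the initial data lie in the domain of the $k$-th power of the generator). *)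

theory Defs
  imports "HOL-Analysis.Analysis"
begin

section \<open>The Hilbert space L2(0,1)\<close>

abbreviation unit_leb :: "real measure" where
  "unit_leb \<equiv> lebesgue_on {0<..<1}"

definition sq_integrable :: "(real \<Rightarrow> real) \<Rightarrow> bool" where
  "sq_integrable f \<longleftrightarrow> f \<in> borel_measurable unit_leb \<and> integrable unit_leb (\<lambda>x. (f x)\<^sup>2)"

lemma sq_integrable_zero [simp]: "sq_integrable (\<lambda>x. 0)"
  by (simp add: sq_integrable_def)

lemma sq_integrable_mult:
  assumes "sq_integrable f" "sq_integrable g"
  shows "integrable unit_leb (\<lambda>x. f x * g x)"
proof (rule Bochner_Integration.integrable_bound)
  show "integrable unit_leb (\<lambda>x. (f x)\<^sup>2 + (g x)\<^sup>2)"
    using assms by (auto simp: sq_integrable_def)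
  show "(\<lambda>x. f x * g x) \<in> borel_measurable unit_leb"
    using assms by (auto simp: sq_integrable_def)
  have "\<bar>y * z\<bar> \<le> y\<^sup>2 + z\<^sup>2" for y z :: real
  proof -
    have "2 * (\<bar>y\<bar> * \<bar>z\<bar>) \<le> y\<^sup>2 + z\<^sup>2"
      using sum_squares_bound[of "\<bar>y\<bar>" "\<bar>z\<bar>"] by simp
    moreover have "0 \<le> \<bar>y\<bar> * \<bar>z\<bar>" by simp
    ultimately show ?thesis unfolding abs_mult by linarith
  qed
  then show "AE x in unit_leb. norm (f x * g x) \<le> norm ((f x)\<^sup>2 + (g x)\<^sup>2)"
    by (auto intro!: AE_I2)
qed

lemma sq_integrable_add:
  assumes "sq_integrable f" "sq_integrable g"
  shows "sq_integrable (\<lambda>x. f x + g x)"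
  using assms sq_integrable_mult[OF assms]
  by (auto simp: sq_integrable_def power2_sum mult.assoc)

lemma sq_integrable_scale:
  assumes "sq_integrable f"
  shows "sq_integrable (\<lambda>x. c * f x)"
  using assms by (auto simp: sq_integrable_def power_mult_distrib)

quotient_type l2 = "real \<Rightarrow> real" / partial:
  "\<lambda>f g. sq_integrable f \<and> sq_integrable g \<and> (AE x in unit_leb. f x = g x)"
proof (rule part_equivpI)
  show "\<exists>f. sq_integrable f \<and> sq_integrable f \<and> (AE x in unit_leb. f x = f x)"
    by (intro exI[of _ "\<lambda>x. 0"]) simp
  show "symp (\<lambda>f g. sq_integrable f \<and> sq_integrable g \<and> (AE x in unit_leb. f x = g x))"
    by (rule sympI) (auto simp: eq_commute)
  show "transp (\<lambda>f g. sq_integrable f \<and> sq_integrable g \<and> (AE x in unit_leb. f x = g x))"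
    by (rule transpI) auto
qed

instantiation l2 :: real_inner
begin

lift_definition zero_l2 :: l2 is "\<lambda>x. 0" by simp

lift_definition plus_l2 :: "l2 \<Rightarrow> l2 \<Rightarrow> l2" is "\<lambda>f g x. f x + g x"
  by (auto intro: sq_integrable_add)

lift_definition uminus_l2 :: "l2 \<Rightarrow> l2" is "\<lambda>f x. - f x"
  using sq_integrable_scale[of _ "-1"] by auto

definition minus_l2 :: "l2 \<Rightarrow> l2 \<Rightarrow> l2" where
  "minus_l2 f g = f + - g"

lift_definition scaleR_l2 :: "real \<Rightarrow> l2 \<Rightarrow> l2" is "\<lambda>c f x. c * f x"
  by (auto intro: sq_integrable_scale)

lift_definition inner_l2 :: "l2 \<Rightarrow> l2 \<Rightarrow> real" is
  "\<lambda>f g. integral\<^sup>L unit_leb (\<lambda>x. f x * g x)"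
  by (rule integral_cong_AE) (auto simp: sq_integrable_def)

definition norm_l2 :: "l2 \<Rightarrow> real" where
  "norm_l2 f = sqrt (inner f f)"

definition sgn_l2 :: "l2 \<Rightarrow> l2" where
  "sgn_l2 f = inverse (norm f) *\<^sub>R f"

definition dist_l2 :: "l2 \<Rightarrow> l2 \<Rightarrow> real" where
  "dist_l2 f g = norm (f - g)"

definition uniformity_l2 :: "(l2 \<times> l2) filter" where
  "uniformity_l2 = (INF e\<in>{0<..}. principal {(x, y). dist x y < e})"

definition open_l2 :: "l2 set \<Rightarrow> bool" where
  "open_l2 U = (\<forall>x\<in>U. eventually (\<lambda>(x', y). x' = x \<longrightarrow> y \<in> U) uniformity)"

instance
proof
  fix f g h :: l2 and c d :: real
  show "f + g + h = f + (g + h)"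
    by transfer (auto simp: add.assoc intro!: sq_integrable_add)
  show "f + g = g + f"
    by transfer (auto simp: add.commute intro!: sq_integrable_add)
  show "0 + f = f" by transfer auto
  show "- f + f = 0" by transfer auto
  show "f - g = f + - g" by (rule minus_l2_def)
  show "c *\<^sub>R (f + g) = c *\<^sub>R f + c *\<^sub>R g"
    by transfer (auto simp: distrib_left intro!: sq_integrable_add sq_integrable_scale)
  show "(c + d) *\<^sub>R f = c *\<^sub>R f + d *\<^sub>R f"
    by transfer (auto simp: distrib_right intro!: sq_integrable_add sq_integrable_scale)
  show "c *\<^sub>R d *\<^sub>R f = (c * d) *\<^sub>R f"
    by transfer (auto simp: mult.assoc intro!: sq_integrable_scale)
  show "1 *\<^sub>R f = f" by transfer auto
  show "inner f g = inner g f" by transfer (simp add: mult.commute)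
  show "inner (f + g) h = inner f h + inner g h"
    by transfer (auto simp: distrib_right sq_integrable_mult)
  show "inner (c *\<^sub>R f) g = c * inner f g"
    by transfer (auto simp: mult.assoc)
  show "0 \<le> inner f f" by transfer (auto intro: integral_nonneg_AE)
  show "(inner f f = 0) = (f = 0)"
  proof transfer
    fix f :: "real \<Rightarrow> real"
    assume "sq_integrable f \<and> sq_integrable f \<and> (AE x in unit_leb. f x = f x)"
    then have f: "sq_integrable f" by simp
    then have "(integral\<^sup>L unit_leb (\<lambda>x. f x * f x) = 0) \<longleftrightarrow> (AE x in unit_leb. f x * f x = 0)"
      by (intro integral_nonneg_eq_0_iff_AE sq_integrable_mult) auto
    then show "(integral\<^sup>L unit_leb (\<lambda>x. f x * f x) = 0) \<longleftrightarrow>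
        (sq_integrable f \<and> sq_integrable (\<lambda>x. 0) \<and> (AE x in unit_leb. f x = 0))"
      using f by simp
  qed
  show "norm f = sqrt (inner f f)" by (rule norm_l2_def)
  show "sgn f = inverse (norm f) *\<^sub>R f" by (rule sgn_l2_def)
  show "dist f g = norm (f - g)" by (rule dist_l2_def)
  show "(uniformity :: (l2 \<times> l2) filter) = (INF e\<in>{0<..}. principal {(x, y). dist x y < e})"
    by (rule uniformity_l2_def)
  show "open U = (\<forall>x\<in>U. eventually (\<lambda>(x', y). x' = x \<longrightarrow> y \<in> U) uniformity)" for U :: "l2 set"
    by (rule open_l2_def)
qed

end

text \<open>The class of \<open>f\<close>; the value is meaningful only if \<open>sq_integrable f\<close>.\<close>

definition l2_class :: "(real \<Rightarrow> real) \<Rightarrow> l2" where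
  "l2_class f = abs_l2 f"

text \<open>Multiplication by a coefficient. The result does not depend on the representative chosen
  by \<open>rep_l2\<close>, and the product is square integrable whenever \<open>a\<close> is measurable and bounded.\<close>

definition l2_mult :: "(real \<Rightarrow> real) \<Rightarrow> l2 \<Rightarrow> l2" where
  "l2_mult a u = l2_class (\<lambda>x. a x * rep_l2 u x)"


section \<open>Sobolev spaces on (0,1)\<close>

text \<open>Test functions are the continuously differentiable functions with compact support in (0,1),
  extended by zero to the line. As in Brezis' treatment of the one-dimensional case, they are used
  both for the weak derivative and for \<open>H1_0\<close>; smooth test functions give the same spaces.\<close>

definition test_function :: "(real \<Rightarrow> real) \<Rightarrow> bool" where
  "test_function \<phi> \<longleftrightarrow> \<phi> differentiable_on UNIV \<and> continuous_on UNIV (deriv \<phi>) \<and>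
     (\<exists>K. compact K \<and> K \<subseteq> {0<..<1} \<and> (\<forall>x. x \<notin> K \<longrightarrow> \<phi> x = 0))"

definition has_weak_deriv :: "l2 \<Rightarrow> l2 \<Rightarrow> bool" where
  "has_weak_deriv u v \<longleftrightarrow>
     (\<forall>\<phi>. test_function \<phi> \<longrightarrow> inner u (l2_class (deriv \<phi>)) = - inner v (l2_class \<phi>))"

definition H1 :: "l2 set" where
  "H1 = {u. \<exists>v. has_weak_deriv u v}"

text \<open>The choice is immaterial, as weak derivatives are unique in \<open>L2\<close>.\<close>

definition weak_deriv :: "l2 \<Rightarrow> l2" where
  "weak_deriv u = (SOME v. has_weak_deriv u v)"

text \<open>The closure of the test functions in the norm of \<open>H1\<close>.\<close>

definition H1_0 :: "l2 set" where
  "H1_0 = {p \<in> H1. \<exists>\<phi>. (\<forall>n. test_function (\<phi> n)) \<and>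
     (\<lambda>n::nat. l2_class (\<phi> n)) \<longlonglongrightarrow> p \<and>
     (\<lambda>n. l2_class (deriv (\<phi> n))) \<longlonglongrightarrow> weak_deriv p}"


section \<open>The damped wave system\<close>

definition gen_dom :: "(l2 \<times> l2) set" where
  "gen_dom = H1 \<times> H1_0"

definition gen :: "(real \<Rightarrow> real) \<Rightarrow> l2 \<times> l2 \<Rightarrow> l2 \<times> l2" where
  "gen a = (\<lambda>(u, p). (- weak_deriv p - l2_mult a u, - weak_deriv u))"

text \<open>Mild solutions of the abstract Cauchy problem \<open>z' = gen a z\<close> on \<open>[0, T]\<close> in the sense of
  semigroup theory (Engel--Nagel, Definition II.6.3): the integrated equation holds. The initial
  datum is \<open>z 0\<close>; the boundary condition on \<open>p\<close> is part of \<open>gen_dom\<close>.\<close>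

definition mild_solution :: "(real \<Rightarrow> real) \<Rightarrow> real \<Rightarrow> (real \<Rightarrow> l2) \<Rightarrow> (real \<Rightarrow> l2) \<Rightarrow> bool" where
  "mild_solution a T u p \<longleftrightarrow>
     continuous_on {0..T} (\<lambda>t. (u t, p t)) \<and>
     (\<forall>t\<in>{0..T}. \<exists>Z. ((\<lambda>s. (u s, p s)) has_integral Z) {0..t} \<and> Z \<in> gen_dom \<and>
        (u t, p t) = (u 0, p 0) + gen a Z)"

text \<open>Iterated strong time derivatives in \<open>L2\<close>, one-sided at the endpoints of \<open>[0, T]\<close>.\<close>

definition time_deriv :: "real \<Rightarrow> nat \<Rightarrow> (real \<Rightarrow> l2) \<Rightarrow> real \<Rightarrow> l2" where
  "time_deriv T k = ((\<lambda>w t. vector_derivative w (at t within {0..T})) ^^ k)"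

definition energy :: "real \<Rightarrow> nat \<Rightarrow> (real \<Rightarrow> l2) \<Rightarrow> (real \<Rightarrow> l2) \<Rightarrow> real \<Rightarrow> real" where
  "energy T k u p t = 1/2 * ((norm (time_deriv T k u t))\<^sup>2 + (norm (time_deriv T k p t))\<^sup>2)"

text \<open>Finiteness of the energy of order \<open>k\<close> at the initial time: the derivatives up to order \<open>k\<close>
  exist and those of order \<open>k\<close> again form a mild solution.\<close>

definition finite_energy ::
    "(real \<Rightarrow> real) \<Rightarrow> real \<Rightarrow> nat \<Rightarrow> (real \<Rightarrow> l2) \<Rightarrow> (real \<Rightarrow> l2) \<Rightarrow> bool" where
  "finite_energy a T k u p \<longleftrightarrow>
     (\<forall>j<k. \<forall>t\<in>{0..T}. time_deriv T j u differentiable (at t within {0..T}) \<and>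
                        time_deriv T j p differentiable (at t within {0..T})) \<and>
     mild_solution a T (time_deriv T k u) (time_deriv T k p)"

end

theory Submission
  imports Defs
begin

text \<open>Only the case \<open>k = 0\<close> is needed, as the time derivatives of order \<open>k\<close> again form a mild
  solution. For a mild solution \<open>(v, q)\<close> with primitive in time \<open>(Z1, Z2)\<close> let \<open>U = u0 + Z1\<close>, with \<open>u0\<close>
  chosen such that \<open>\<partial>\<^sub>x U = - q\<close> and \<open>\<integral> a U = - \<integral> v\<close>; then \<open>\<partial>\<^sub>t U = v\<close>, and a Poincare inequality with
  weight \<open>a\<close> gives \<open>\<parallel>U\<parallel> \<le> \<parallel>q\<parallel> + \<parallel>v\<parallel> / a0\<close>. The energy satisfies \<open>E' = - (a v, v)\<close>, by passing to the
  limit in the identity for difference quotients of \<open>(Z1, Z2)\<close>, and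
  \<open>(v, U)' = \<parallel>v\<parallel>\<^sup>2 - \<parallel>q\<parallel>\<^sup>2 - (a v, U)\<close>. For \<open>\<epsilon> = rate\<close> below the functional \<open>E + \<epsilon> (v, U)\<close> lies between \<open>E / 2\<close> and
  \<open>3 E / 2\<close> and decays with rate \<open>2 \<epsilon> / 3\<close>.\<close>

section \<open>Square integrable functions and their classes\<close>


text \<open>The obstacle is regularity: \<open>v\<close> and \<open>q\<close> are merely continuous
  in time, and only their time integrals lie in the domain of the generator. Hence space derivatives
  are taken only of \<open>Z1\<close>, \<open>Z2\<close> and \<open>U\<close>, and derivatives of
  \<open>v\<close> and \<open>q\<close> are replaced by differences of the integrated equations. The
  normalisation of \<open>U\<close> rests on an invariant: the derivative in space of
  \<open>Z2\<close> has mean zero because \<open>Z2\<close> vanishes at both ends, so the integral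
  of \<open>v + a U\<close> does not change in time. Choosing the free constant in \<open>u0\<close>
  to make it zero controls the weighted mean of \<open>U\<close> by \<open>v\<close> alone.
  \<open>H1_0\<close> is a closure of test functions, so the Poincare inequality by duality requires
  primitives of mean-zero functions to be limits of test functions; this is what the density results
  are for. The factor 3 is the quotient of the two bounds \<open>3/4\<close> and \<open>1/4\<close>
  of the functional relative to \<open>sq_norm\<close>, which is twice the energy.\<close>

lemma l2_class_rep [simp]: "l2_class (rep_l2 u) = u"
  unfolding l2_class_def using Quotient_l2 by (rule Quotient_abs_rep)

lemma sq_integrable_rep [simp]: "sq_integrable (rep_l2 u)"
  using Quotient_rep_reflp[OF Quotient_l2] by blast

lemma l2_class_eq_iff:
  assumes "sq_integrable f" "sq_integrable g"
  shows "l2_class f = l2_class g \<longleftrightarrow> (AE x in unit_leb. f x = g x)"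
  using Quotient_rel[OF Quotient_l2, of f g] assms by (simp add: l2_class_def)

lemma rep_l2_class:
  assumes "sq_integrable f"
  shows "AE x in unit_leb. rep_l2 (l2_class f) x = f x"
  using l2_class_eq_iff[OF sq_integrable_rep assms, of "l2_class f"] l2_class_rep[of "l2_class f"] by blast

lemma l2_class_zero [simp]: "l2_class (\<lambda>x. 0) = 0"
  by (simp add: l2_class_def zero_l2_def)

lemma l2_class_add:
  assumes "sq_integrable f" "sq_integrable g"
  shows "l2_class f + l2_class g = l2_class (\<lambda>x. f x + g x)"
  unfolding l2_class_def by (rule plus_l2.abs_eq) (use assms in auto)

lemma l2_class_scale:
  assumes "sq_integrable f"
  shows "c *\<^sub>R l2_class f = l2_class (\<lambda>x. c * f x)"
  unfolding l2_class_def by (rule scaleR_l2.abs_eq) (use assms in auto)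

lemma sq_integrable_diff:
  assumes "sq_integrable f" "sq_integrable g"
  shows "sq_integrable (\<lambda>x. f x - g x)"
  using sq_integrable_add[OF assms(1) sq_integrable_scale[OF assms(2), of "-1"]] by simp

lemma l2_class_diff:
  assumes "sq_integrable f" "sq_integrable g"
  shows "l2_class f - l2_class g = l2_class (\<lambda>x. f x - g x)"
proof -
  have "l2_class f - l2_class g = l2_class f + (-1) *\<^sub>R l2_class g" by simp
  also have "\<dots> = l2_class (\<lambda>x. f x + (-1) * g x)"
    using assms by (simp only: l2_class_scale l2_class_add sq_integrable_scale)
  finally show ?thesis by simp
qed

lemma inner_l2_class:
  assumes "sq_integrable f" "sq_integrable g"
  shows "inner (l2_class f) (l2_class g) = (LINT x|unit_leb. f x * g x)"
  unfolding l2_class_def by (rule inner_l2.abs_eq) (use assms in auto)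

lemma norm_l2_class:
  assumes "sq_integrable f"
  shows "(norm (l2_class f))\<^sup>2 = (LINT x|unit_leb. (f x)\<^sup>2)"
  unfolding power2_norm_eq_inner unfolding power2_eq_square by (rule inner_l2_class[OF assms assms])

lemma emeasure_unit_leb: "emeasure unit_leb (space unit_leb) = 1"
  by (simp add: space_restrict_space emeasure_restrict_space)

lemma finite_measure_unit_leb: "finite_measure unit_leb"
  by (rule finite_measureI) (use emeasure_unit_leb in simp)

lemma integrable_unit_const [simp]: "integrable unit_leb (\<lambda>x. c::real)"
  using finite_measure.integrable_const[OF finite_measure_unit_leb] .

lemma integral_unit_const [simp]: "(LINT x|unit_leb. (c::real)) = c"
  using emeasure_unit_leb by (simp add: measure_def)

lemma space_unit_leb [simp]: "space unit_leb = {0<..<1}"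
  by (simp add: space_restrict_space)

lemma measure_unit_leb [simp]: "measure unit_leb {0<..<1} = 1"
  using emeasure_unit_leb by (simp add: measure_def)

lemma sq_integrable_bounded:
  assumes "f \<in> borel_measurable unit_leb" "\<And>x. 0 < x \<Longrightarrow> x < 1 \<Longrightarrow> \<bar>f x\<bar> \<le> B"
  shows "sq_integrable f"
  unfolding sq_integrable_def
proof
  show "integrable unit_leb (\<lambda>x. (f x)\<^sup>2)"
  proof (rule Bochner_Integration.integrable_bound[of _ "\<lambda>x. B\<^sup>2"])
    have "(f x)\<^sup>2 \<le> B\<^sup>2" if "0 < x" "x < 1" for x
      using power_mono[OF assms(2)[OF that], of 2] by simp
    then show "AE x in unit_leb. norm ((f x)\<^sup>2) \<le> norm (B\<^sup>2)"
      by (intro AE_I2) simp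
  qed (use assms in auto)
qed fact

lemma sq_integrable_const [simp]: "sq_integrable (\<lambda>x. c)"
  by (rule sq_integrable_bounded[of _ "\<bar>c\<bar>"]) auto

lemma sq_integrable_continuous:
  assumes "continuous_on {0..1} f"
  shows "sq_integrable f"
proof -
  have "bounded (f ` {0..1})"
    using assms by (intro compact_imp_bounded compact_continuous_image) auto
  then obtain B where "\<forall>x\<in>{0..1}. \<bar>f x\<bar> \<le> B"
    unfolding bounded_iff by auto
  moreover have "f \<in> borel_measurable unit_leb"
    by (rule continuous_imp_measurable_on_sets_lebesgue)
      (auto intro: continuous_on_subset[OF assms])
  ultimately show ?thesis by (intro sq_integrable_bounded[of _ B]) auto
qed

lemma sq_integrable_imp_integrable:
  assumes "sq_integrable f"
  shows "integrable unit_leb f"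
  using sq_integrable_mult[OF assms sq_integrable_const[of 1]] by simp

lemma inner_l2_one:
  assumes "sq_integrable f"
  shows "inner (l2_class f) (l2_class (\<lambda>x. 1)) = (LINT x|unit_leb. f x)"
  using inner_l2_class[OF assms sq_integrable_const[of 1]] by simp

lemma norm_l2_one [simp]: "norm (l2_class (\<lambda>x. 1)) = 1"
  using norm_l2_class[OF sq_integrable_const[of 1]] norm_ge_zero[of "l2_class (\<lambda>x. 1)"]
  by (simp add: power2_eq_1_iff)

text \<open>Cauchy-Schwarz against the constant one, whose norm is one because the interval has unit
  length.\<close>

lemma integral_abs_le_norm:
  assumes "sq_integrable f"
  shows "(LINT x|unit_leb. \<bar>f x\<bar>) \<le> norm (l2_class f)"
proof -
  have abs: "sq_integrable (\<lambda>x. \<bar>f x\<bar>)" using assms by (auto simp: sq_integrable_def)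
  have "(norm (l2_class (\<lambda>x. \<bar>f x\<bar>)))\<^sup>2 = (norm (l2_class f))\<^sup>2"
    by (simp add: norm_l2_class abs assms)
  then have "norm (l2_class (\<lambda>x. \<bar>f x\<bar>)) = norm (l2_class f)"
    by (simp add: power2_eq_iff_nonneg)
  moreover have "(LINT x|unit_leb. \<bar>f x\<bar>) \<le> norm (l2_class (\<lambda>x. \<bar>f x\<bar>)) * norm (l2_class (\<lambda>x. 1))"
    unfolding inner_l2_one[OF abs, symmetric] by (rule norm_cauchy_schwarz)
  ultimately show ?thesis by simp
qed

lemma norm_l2_class_le:
  assumes "f \<in> borel_measurable unit_leb" "\<And>x. 0 < x \<Longrightarrow> x < 1 \<Longrightarrow> \<bar>f x\<bar> \<le> B"
  shows "norm (l2_class f) \<le> B"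
proof (rule power2_le_imp_le)
  have f: "sq_integrable f" using assms by (rule sq_integrable_bounded)
  have "(f x)\<^sup>2 \<le> B\<^sup>2" if "0 < x" "x < 1" for x
    using power_mono[OF assms(2)[OF that], of 2] by simp
  then have "(LINT x|unit_leb. (f x)\<^sup>2) \<le> (LINT x|unit_leb. B\<^sup>2)"
    using f by (intro integral_mono) (auto simp: sq_integrable_def)
  then show "(norm (l2_class f))\<^sup>2 \<le> B\<^sup>2" by (simp add: norm_l2_class f)
  show "0 \<le> B" using assms(2)[of "1/2"] by simp
qed

section \<open>Multiplication by the damping coefficient\<close>

locale damping =
  fixes a :: "real \<Rightarrow> real" and a0 a1 :: real
  assumes a0_pos: "0 < a0"
    and measurable_a: "a \<in> borel_measurable unit_leb"
    and a_bounds: "\<And>x. 0 < x \<Longrightarrow> x < 1 \<Longrightarrow> a0 \<le> a x \<and> a x \<le> a1"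
begin

lemma a0_le_a1: "a0 \<le> a1" and a1_pos: "0 < a1"
  using a_bounds[of "1/2"] a0_pos by auto

lemma sq_integrable_mult_a:
  assumes "sq_integrable f"
  shows "sq_integrable (\<lambda>x. a x * f x)"
  unfolding sq_integrable_def
proof
  show meas: "(\<lambda>x. a x * f x) \<in> borel_measurable unit_leb"
    using assms measurable_a by (auto simp: sq_integrable_def)
  show "integrable unit_leb (\<lambda>x. (a x * f x)\<^sup>2)"
  proof (rule Bochner_Integration.integrable_bound[of _ "\<lambda>x. a1\<^sup>2 * (f x)\<^sup>2"])
    have "(a x)\<^sup>2 * (f x)\<^sup>2 \<le> a1\<^sup>2 * (f x)\<^sup>2" if "0 < x" "x < 1" for x
      using a_bounds[OF that] a0_pos by (intro mult_right_mono power_mono) auto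
    then show "AE x in unit_leb. norm ((a x * f x)\<^sup>2) \<le> norm (a1\<^sup>2 * (f x)\<^sup>2)"
      by (intro AE_I2) (simp add: power_mult_distrib)
    show "integrable unit_leb (\<lambda>x. a1\<^sup>2 * (f x)\<^sup>2)"
      using assms by (simp add: sq_integrable_def)
    show "(\<lambda>x. (a x * f x)\<^sup>2) \<in> borel_measurable unit_leb"
      using meas by (rule borel_measurable_power)
  qed
qed

lemma sq_integrable_a: "sq_integrable a"
  using sq_integrable_mult_a[of "\<lambda>x. 1"] by simp

text \<open>The representative picked by \<open>rep_l2\<close> agrees with \<open>f\<close> almost
  everywhere, and so do the products with \<open>a\<close>. This frees later computations from the
  chosen representative.\<close>

lemma l2_mult_class:
  assumes "sq_integrable f"
  shows "l2_mult a (l2_class f) = l2_class (\<lambda>x. a x * f x)"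
proof -
  have "AE x in unit_leb. a x * rep_l2 (l2_class f) x = a x * f x"
    using rep_l2_class[OF assms] by eventually_elim simp
  then show ?thesis
    unfolding l2_mult_def using assms by (subst l2_class_eq_iff) (auto intro: sq_integrable_mult_a)
qed

lemma inner_l2_mult:
  assumes "sq_integrable f" "sq_integrable g"
  shows "inner (l2_mult a (l2_class f)) (l2_class g) = (LINT x|unit_leb. a x * f x * g x)"
  using assms by (simp add: l2_mult_class inner_l2_class sq_integrable_mult_a)

lemma l2_mult_add: "l2_mult a (u + v) = l2_mult a u + l2_mult a v"
proof -
  let ?f = "rep_l2 u" and ?g = "rep_l2 v"
  have "l2_mult a (l2_class ?f + l2_class ?g) = l2_mult a (l2_class ?f) + l2_mult a (l2_class ?g)"
    by (simp only: l2_class_add l2_mult_class sq_integrable_rep sq_integrable_add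
        sq_integrable_mult_a distrib_left)
  then show ?thesis by simp
qed

lemma l2_mult_scale: "l2_mult a (c *\<^sub>R u) = c *\<^sub>R l2_mult a u"
proof -
  have "l2_mult a (c *\<^sub>R l2_class (rep_l2 u)) = c *\<^sub>R l2_mult a (l2_class (rep_l2 u))"
    by (simp only: l2_class_scale l2_mult_class sq_integrable_rep sq_integrable_scale
        sq_integrable_mult_a mult.left_commute)
  then show ?thesis by simp
qed

lemma inner_l2_mult_commute: "inner (l2_mult a u) v = inner u (l2_mult a v)"
proof -
  have "inner (l2_mult a (l2_class (rep_l2 u))) (l2_class (rep_l2 v))
      = inner (l2_mult a (l2_class (rep_l2 v))) (l2_class (rep_l2 u))"
    by (simp only: inner_l2_mult sq_integrable_rep mult.assoc) (simp only: mult.commute)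
  then show ?thesis by (simp add: inner_commute)
qed

lemma norm_l2_mult_le: "norm (l2_mult a u) \<le> a1 * norm u"
proof (rule power2_le_imp_le)
  let ?f = "rep_l2 u"
  have f: "sq_integrable (\<lambda>x. a x * ?f x)" by (intro sq_integrable_mult_a) simp
  have "(norm (l2_mult a u))\<^sup>2 = (LINT x|unit_leb. (a x * ?f x)\<^sup>2)"
    unfolding l2_mult_def by (rule norm_l2_class) (rule f)
  also have "\<dots> \<le> (LINT x|unit_leb. a1\<^sup>2 * (?f x)\<^sup>2)"
  proof (rule integral_mono)
    show "(a x * ?f x)\<^sup>2 \<le> a1\<^sup>2 * (?f x)\<^sup>2" if "x \<in> space unit_leb" for x
      unfolding power_mult_distrib using that a_bounds[of x] a0_pos
      by (intro mult_right_mono power_mono) auto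
  qed (use f sq_integrable_rep[of u] in \<open>auto simp: sq_integrable_def\<close>)
  also have "\<dots> = (a1 * norm u)\<^sup>2"
    using norm_l2_class[OF sq_integrable_rep[of u]] by (simp add: power_mult_distrib)
  finally show "(norm (l2_mult a u))\<^sup>2 \<le> (a1 * norm u)\<^sup>2" .
qed (use a1_pos in simp)

lemma inner_l2_mult_ge: "a0 * (norm u)\<^sup>2 \<le> inner (l2_mult a u) u"
proof -
  let ?f = "rep_l2 u"
  have "a0 * (norm u)\<^sup>2 = (LINT x|unit_leb. a0 * (?f x)\<^sup>2)"
    using norm_l2_class[OF sq_integrable_rep[of u]] by simp
  also have "\<dots> \<le> (LINT x|unit_leb. a x * ?f x * ?f x)"
  proof (rule integral_mono)
    show "integrable unit_leb (\<lambda>x. a x * ?f x * ?f x)"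
      by (intro sq_integrable_mult sq_integrable_mult_a) auto
    show "a0 * (?f x)\<^sup>2 \<le> a x * ?f x * ?f x" if "x \<in> space unit_leb" for x
      using that a_bounds[of x] by (simp add: power2_eq_square mult_right_mono mult.assoc)
  qed (use sq_integrable_rep[of u] in \<open>auto simp: sq_integrable_def\<close>)
  also have "\<dots> = inner (l2_mult a u) u"
    using inner_l2_mult[OF sq_integrable_rep[of u] sq_integrable_rep[of u]] by simp
  finally show ?thesis .
qed

lemma bounded_linear_l2_mult: "bounded_linear (l2_mult a)"
  by (rule bounded_linear_intro[where K = a1])
    (use norm_l2_mult_le l2_mult_add l2_mult_scale in \<open>auto simp: mult.commute\<close>)

end

section \<open>Weak derivatives and primitives\<close>


lemma integral_unit_leb_eq:
  fixes f :: "real \<Rightarrow> real"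
  assumes "integrable unit_leb f"
  shows "f integrable_on {0..1}" "(LINT x|unit_leb. f x) = integral {0..1} f"
proof -
  have "f integrable_on {0<..<1}" by (rule integrable_on_lebesgue_on[OF assms]) simp
  then show "f integrable_on {0..1}" by (simp add: integrable_on_Icc_iff_Ioo)
  show "(LINT x|unit_leb. f x) = integral {0..1} f"
    using lebesgue_integral_eq_integral[OF assms] by (simp add: integral_open_interval_real)
qed

lemma integral_unit_leb_FTC:
  assumes "\<And>x. x \<in> {0..1} \<Longrightarrow> (F has_real_derivative f x) (at x within {0..1})"
    and "continuous_on {0..1} f"
  shows "(LINT x|unit_leb. f x) = F 1 - F 0"
proof -
  have "(f has_integral F 1 - F 0) {0..1}"
    using assms(1)
    by (intro fundamental_theorem_of_calculus) (auto simp: has_real_derivative_iff_has_vector_derivative)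
  then show ?thesis
    using integral_unit_leb_eq(2)[OF sq_integrable_imp_integrable[OF sq_integrable_continuous[OF assms(2)]]]
    by (simp add: integral_unique)
qed

lemma test_functionD:
  assumes "test_function \<phi>"
  shows "(\<phi> has_real_derivative deriv \<phi> x) (at x within S)"
    "continuous_on S \<phi>" "continuous_on S (deriv \<phi>)" "\<phi> 0 = 0" "\<phi> 1 = 0"
proof -
  have "\<phi> field_differentiable (at x)"
    using assms by (auto simp: test_function_def differentiable_on_def field_differentiable_def
        real_differentiable_def)
  then show "(\<phi> has_real_derivative deriv \<phi> x) (at x within S)"
    by (metis DERIV_deriv_iff_field_differentiable has_field_derivative_at_within)
  show "continuous_on S \<phi>"
    using assms differentiable_imp_continuous_on continuous_on_subset
    unfolding test_function_def by blast
  show "continuous_on S (deriv \<phi>)"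
    using assms continuous_on_subset unfolding test_function_def by blast
  show "\<phi> 0 = 0" "\<phi> 1 = 0"
    using assms unfolding test_function_def by (auto simp: subset_iff)
qed

lemma sq_integrable_test [simp]:
  assumes "test_function \<phi>"
  shows "sq_integrable \<phi>" "sq_integrable (deriv \<phi>)"
  using test_functionD[OF assms] by (auto intro: sq_integrable_continuous)

text \<open>Integration by parts: the product of \<open>F\<close> with a test function vanishes at 0
  and 1, so the integral of its derivative is zero.\<close>

lemma has_weak_deriv_C1:
  assumes "\<And>x. x \<in> {0..1} \<Longrightarrow> (F has_real_derivative f x) (at x within {0..1})"
    and "continuous_on {0..1} f"
  shows "has_weak_deriv (l2_class F) (l2_class f)"
  unfolding has_weak_deriv_def
proof (intro allI impI)
  fix \<phi> assume \<phi>: "test_function \<phi>"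
  have cF: "continuous_on {0..1} F"
    using assms(1) by (meson DERIV_continuous_on)
  have F: "sq_integrable F" and f: "sq_integrable f"
    using cF assms(2) by (auto intro: sq_integrable_continuous)
  have "(LINT x|unit_leb. F x * deriv \<phi> x + f x * \<phi> x) = F 1 * \<phi> 1 - F 0 * \<phi> 0"
  proof (rule integral_unit_leb_FTC)
    show "((\<lambda>x. F x * \<phi> x) has_real_derivative F x * deriv \<phi> x + f x * \<phi> x) (at x within {0..1})"
      if "x \<in> {0..1}" for x
      using DERIV_mult[OF assms(1)[OF that] test_functionD(1)[OF \<phi>]] by (simp add: algebra_simps)
    show "continuous_on {0..1} (\<lambda>x. F x * deriv \<phi> x + f x * \<phi> x)"
      by (intro continuous_intros cF assms(2) test_functionD[OF \<phi>])
  qed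
  moreover have "(LINT x|unit_leb. F x * deriv \<phi> x + f x * \<phi> x)
      = (LINT x|unit_leb. F x * deriv \<phi> x) + (LINT x|unit_leb. f x * \<phi> x)"
    by (rule Bochner_Integration.integral_add) (use F f \<phi> in \<open>auto intro: sq_integrable_mult\<close>)
  ultimately show "inner (l2_class F) (l2_class (deriv \<phi>)) = - inner (l2_class f) (l2_class \<phi>)"
    using test_functionD(4,5)[OF \<phi>] by (simp add: inner_l2_class F f \<phi>)
qed

lemma has_weak_deriv_test: "test_function \<phi> \<Longrightarrow> has_weak_deriv (l2_class \<phi>) (l2_class (deriv \<phi>))"
  by (rule has_weak_deriv_C1) (auto intro: test_functionD)

lemma has_weak_deriv_const: "has_weak_deriv (l2_class (\<lambda>x. c)) 0"
  using has_weak_deriv_C1[of "\<lambda>x. c" "\<lambda>x. 0"] by simp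

lemma has_weak_deriv_ident: "has_weak_deriv (l2_class (\<lambda>x. x)) (l2_class (\<lambda>x. 1))"
  by (rule has_weak_deriv_C1) (auto intro!: derivative_eq_intros)

lemma has_weak_deriv_add:
  "has_weak_deriv u v \<Longrightarrow> has_weak_deriv u' v' \<Longrightarrow> has_weak_deriv (u + u') (v + v')"
  by (simp add: has_weak_deriv_def inner_add_left)

lemma has_weak_deriv_scale: "has_weak_deriv u v \<Longrightarrow> has_weak_deriv (c *\<^sub>R u) (c *\<^sub>R v)"
  by (simp add: has_weak_deriv_def)

lemma has_weak_deriv_diff:
  "has_weak_deriv u v \<Longrightarrow> has_weak_deriv u' v' \<Longrightarrow> has_weak_deriv (u - u') (v - v')"
  by (simp add: has_weak_deriv_def inner_diff_left)

text \<open>Working with this relation and \<open>has_weak_deriv\<close>, both linear by construction, avoids proving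
  that weak derivatives are unique.\<close>

definition H10_deriv :: "l2 \<Rightarrow> l2 \<Rightarrow> bool" where
  "H10_deriv p r \<longleftrightarrow> (\<exists>\<phi>. (\<forall>n. test_function (\<phi> n)) \<and>
     (\<lambda>n::nat. l2_class (\<phi> n)) \<longlonglongrightarrow> p \<and> (\<lambda>n. l2_class (deriv (\<phi> n))) \<longlonglongrightarrow> r)"

lemma weak_deriv_H1: "u \<in> H1 \<Longrightarrow> has_weak_deriv u (weak_deriv u)"
  unfolding H1_def weak_deriv_def by (auto intro: someI)

lemma weak_deriv_H1_0: "p \<in> H1_0 \<Longrightarrow> H10_deriv p (weak_deriv p)"
  unfolding H1_0_def H10_deriv_def by blast

text \<open>The defining identity of the weak derivative passes to the limit along test functions
  approximating \<open>p\<close>. This is integration by parts without boundary terms although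
  \<open>u\<close> has no boundary values prescribed; every use of the boundary condition on
  \<open>p\<close> goes through it.\<close>

lemma H10_deriv_inner:
  assumes "H10_deriv p r" "has_weak_deriv u w"
  shows "inner u r = - inner w p"
proof -
  obtain \<phi> where \<phi>: "\<And>n. test_function (\<phi> n)" and lim: "(\<lambda>n. l2_class (\<phi> n)) \<longlonglongrightarrow> p"
      "(\<lambda>n. l2_class (deriv (\<phi> n))) \<longlonglongrightarrow> r"
    using assms(1) unfolding H10_deriv_def by blast
  have "(\<lambda>n. inner u (l2_class (deriv (\<phi> n)))) \<longlonglongrightarrow> inner u r"
    by (intro tendsto_intros lim)
  moreover have "(\<lambda>n. - inner w (l2_class (\<phi> n))) \<longlonglongrightarrow> - inner w p"
    by (intro tendsto_intros lim)
  moreover have "inner u (l2_class (deriv (\<phi> n))) = - inner w (l2_class (\<phi> n))" for n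
    using assms(2) \<phi> unfolding has_weak_deriv_def by blast
  ultimately show ?thesis using LIMSEQ_unique by simp
qed

text \<open>A test function takes the role of \<open>u\<close> in the preceding formula.\<close>

lemma H10_deriv_imp_has_weak_deriv:
  assumes "H10_deriv p r"
  shows "has_weak_deriv p r"
  unfolding has_weak_deriv_def
proof (intro allI impI)
  fix \<phi> assume "test_function \<phi>"
  from H10_deriv_inner[OF assms has_weak_deriv_test[OF this]]
  show "inner p (l2_class (deriv \<phi>)) = - inner r (l2_class \<phi>)"
    by (simp add: inner_commute)
qed

section \<open>Primitives and their bounds\<close>

definition primitive :: "(real \<Rightarrow> real) \<Rightarrow> real \<Rightarrow> real" where
  "primitive f x = integral {0..x} f"

lemma sq_integrable_integrable_on:
  assumes "sq_integrable f" "0 \<le> x" "y \<le> 1"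
  shows "f integrable_on {x..y}" "(\<lambda>z. \<bar>f z\<bar>) integrable_on {x..y}"
proof -
  have "f integrable_on {0..1}" "(\<lambda>z. \<bar>f z\<bar>) integrable_on {0..1}"
    using sq_integrable_imp_integrable[OF assms(1)] by (auto intro: integral_unit_leb_eq)
  then show "f integrable_on {x..y}" "(\<lambda>z. \<bar>f z\<bar>) integrable_on {x..y}"
    using assms(2,3) by (auto intro: integrable_on_subinterval)
qed

lemma continuous_on_primitive:
  assumes "sq_integrable f"
  shows "continuous_on {0..1} (primitive f)"
  unfolding primitive_def
  using indefinite_integral_continuous_1[OF sq_integrable_integrable_on(1)[OF assms]] by simp

lemma sq_integrable_primitive: "sq_integrable f \<Longrightarrow> sq_integrable (primitive f)"
  by (rule sq_integrable_continuous) (rule continuous_on_primitive)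

lemma primitive_diff:
  assumes "sq_integrable f" "sq_integrable g" "x \<le> 1"
  shows "primitive (\<lambda>z. f z - g z) x = primitive f x - primitive g x"
  unfolding primitive_def using assms
  by (intro Henstock_Kurzweil_Integration.integral_diff sq_integrable_integrable_on) auto

lemma primitive_one:
  assumes "sq_integrable f"
  shows "primitive f 1 = (LINT x|unit_leb. f x)"
  unfolding primitive_def using integral_unit_leb_eq(2)[OF sq_integrable_imp_integrable[OF assms]] by simp

text \<open>Both terms are dominated by integrals of the absolute value over the two pieces of the
  interval, which add up to the whole. Bounding the sum rather than each term keeps the constant one
  in the Poincare inequality.\<close>

lemma primitive_split_le_norm:
  assumes "sq_integrable f" "0 \<le> x" "x \<le> 1"
  shows "\<bar>primitive f x\<bar> + \<bar>primitive f 1 - primitive f x\<bar> \<le> norm (l2_class f)"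
proof -
  note int = sq_integrable_integrable_on[OF assms(1)]
  have "primitive f 1 - primitive f x = integral {x..1} f"
    using Henstock_Kurzweil_Integration.integral_combine[of 0 x 1 f] assms(2,3) int
    by (simp add: primitive_def)
  moreover have "\<bar>integral {0..x} f\<bar> \<le> integral {0..x} (\<lambda>z. \<bar>f z\<bar>)"
    "\<bar>integral {x..1} f\<bar> \<le> integral {x..1} (\<lambda>z. \<bar>f z\<bar>)"
    using int assms(2,3) integral_norm_bound_integral[of f _ "\<lambda>z. \<bar>f z\<bar>"] by auto
  moreover have "integral {0..x} (\<lambda>z. \<bar>f z\<bar>) + integral {x..1} (\<lambda>z. \<bar>f z\<bar>)
      = integral {0..1} (\<lambda>z. \<bar>f z\<bar>)"
    using assms(2,3) int by (intro Henstock_Kurzweil_Integration.integral_combine) auto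
  moreover have "\<dots> = (LINT x|unit_leb. \<bar>f x\<bar>)"
    using sq_integrable_imp_integrable[OF assms(1)] by (intro integral_unit_leb_eq(2)[symmetric]) simp
  ultimately show ?thesis
    using integral_abs_le_norm[OF assms(1)] by (simp add: primitive_def)
qed

lemma norm_primitive_le:
  assumes "sq_integrable f"
  shows "norm (l2_class (primitive f)) \<le> norm (l2_class f)"
proof (rule norm_l2_class_le)
  show "primitive f \<in> borel_measurable unit_leb"
    using sq_integrable_primitive[OF assms] by (simp add: sq_integrable_def)
  show "\<bar>primitive f x\<bar> \<le> norm (l2_class f)" if "0 < x" "x < 1" for x
    using primitive_split_le_norm[OF assms, of x] that by linarith
qed

text \<open>Writing \<open>B\<close> for the primitive of \<open>b\<close>, the primitive at \<open>x\<close> of the corrected function equals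
  \<open>(1 - B x) * (\<integral>\<^sub>0\<^sup>x f) - B x * (\<integral>\<^sub>x\<^sup>1 f)\<close>.\<close>

lemma norm_primitive_mean_corrected_le:
  assumes f: "sq_integrable f" and b: "sq_integrable b"
    and b_nonneg: "\<And>x. 0 < x \<Longrightarrow> x < 1 \<Longrightarrow> 0 \<le> b x" and b_one: "(LINT x|unit_leb. b x) = 1"
  shows "norm (l2_class (primitive (\<lambda>x. f x - (LINT x|unit_leb. f x) * b x))) \<le> norm (l2_class f)"
proof (rule norm_l2_class_le)
  let ?J = "LINT x|unit_leb. f x"
  have g: "sq_integrable (\<lambda>x. f x - ?J * b x)"
    by (intro sq_integrable_diff sq_integrable_scale f b)
  show "primitive (\<lambda>x. f x - ?J * b x) \<in> borel_measurable unit_leb"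
    using sq_integrable_primitive[OF g] by (simp add: sq_integrable_def)
  fix x :: real assume x: "0 < x" "x < 1"
  define F B where "F = primitive f x" and "B = primitive b x"
  have "primitive (\<lambda>x. ?J * b x) x = ?J * B"
    by (simp add: primitive_def B_def)
  then have eq: "primitive (\<lambda>x. f x - ?J * b x) x = (1 - B) * F - B * (?J - F)"
    using primitive_diff[OF f sq_integrable_scale[OF b], of x ?J] x
    by (simp add: F_def algebra_simps)
  have b_ae: "integral {y..z} b \<ge> 0" if "0 \<le> y" "z \<le> 1" for y z
  proof -
    \<comment> \<open>The sign of \<open>b\<close> is known only inside the unit interval, so the
      endpoints are removed before integrating.\<close>
    have "0 \<le> integral {y<..<z} b"
      using that sq_integrable_integrable_on(1)[OF b that] b_nonneg
      by (intro Henstock_Kurzweil_Integration.integral_nonneg) (auto simp: integrable_on_Icc_iff_Ioo)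
    then show ?thesis by (simp add: integral_open_interval_real)
  qed
  have "integral {0..x} b + integral {x..1} b = integral {0..1} b"
    using x sq_integrable_integrable_on(1)[OF b]
    by (intro Henstock_Kurzweil_Integration.integral_combine) auto
  then have B: "0 \<le> B" "B \<le> 1"
    using b_ae[of 0 x] b_ae[of x 1] x primitive_one[OF b] b_one
    by (auto simp: B_def primitive_def)
  have "\<bar>(1 - B) * F - B * (?J - F)\<bar> \<le> (1 - B) * \<bar>F\<bar> + B * \<bar>?J - F\<bar>"
    using abs_triangle_ineq4[of "(1 - B) * F" "B * (?J - F)"] B by (simp add: abs_mult)
  also have "\<dots> \<le> 1 * \<bar>F\<bar> + 1 * \<bar>?J - F\<bar>"
    using B by (intro add_mono mult_right_mono) auto
  also have "\<dots> \<le> norm (l2_class f)"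
    using primitive_split_le_norm[OF f, of x] x primitive_one[OF f] by (simp add: F_def)
  finally show "\<bar>primitive (\<lambda>x. f x - ?J * b x) x\<bar> \<le> norm (l2_class f)"
    using eq by simp
qed

text \<open>A symmetric interval with a margin records the support: two functions share the smaller
  margin, and a primitive is constant on either side of the interval.\<close>

definition compactly_supported :: "(real \<Rightarrow> real) \<Rightarrow> bool" where
  "compactly_supported c \<longleftrightarrow> continuous_on UNIV c \<and>
     (\<exists>\<delta>. 0 < \<delta> \<and> \<delta> < 1/2 \<and> (\<forall>x. x \<notin> {\<delta>..1-\<delta>} \<longrightarrow> c x = 0))"

lemma compactly_supported_diff_scale:
  assumes "compactly_supported c" "compactly_supported d"
  shows "compactly_supported (\<lambda>x. c x - m * d x)"
proof -
  obtain \<delta> \<eta> where "0 < \<delta>" "\<delta> < 1/2" "\<And>x. x \<notin> {\<delta>..1-\<delta>} \<Longrightarrow> c x = 0"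
    and "0 < \<eta>" "\<eta> < 1/2" "\<And>x. x \<notin> {\<eta>..1-\<eta>} \<Longrightarrow> d x = 0"
    using assms unfolding compactly_supported_def by blast
  moreover have "x \<notin> {\<delta>..1-\<delta>} \<and> x \<notin> {\<eta>..1-\<eta>}" if "x \<notin> {min \<delta> \<eta>..1 - min \<delta> \<eta>}" for x
    using that by auto
  ultimately have "\<exists>\<delta>. 0 < \<delta> \<and> \<delta> < 1/2 \<and> (\<forall>x. x \<notin> {\<delta>..1-\<delta>} \<longrightarrow> c x - m * d x = 0)"
    by (intro exI[of _ "min \<delta> \<eta>"]) (simp del: atLeastAtMost_iff)
  moreover have "continuous_on UNIV (\<lambda>x. c x - m * d x)"
    using assms unfolding compactly_supported_def by (auto intro!: continuous_intros)
  ultimately show ?thesis unfolding compactly_supported_def by blast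
qed

lemma sq_integrable_compactly_supported: "compactly_supported c \<Longrightarrow> sq_integrable c"
  unfolding compactly_supported_def by (meson continuous_on_subset sq_integrable_continuous subset_UNIV)

text \<open>To the left of the support the primitive is zero, to the right it is constant and equal
  to the full integral, which vanishes by assumption. So every such function of mean zero is the
  derivative of a test function.\<close>

lemma primitive_test_function:
  assumes c: "compactly_supported c" and mean: "(LINT x|unit_leb. c x) = 0"
  shows "test_function (primitive c)" "deriv (primitive c) = c"
proof -
  obtain \<delta> where \<delta>: "0 < \<delta>" "\<delta> < 1/2" and c0: "\<And>x. x \<notin> {\<delta>..1-\<delta>} \<Longrightarrow> c x = 0"
    using c unfolding compactly_supported_def by blast
  have cont: "continuous_on S c" for S
    using c unfolding compactly_supported_def by (meson continuous_on_subset subset_UNIV)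
  \<comment> \<open>Negative \<open>x\<close> is included: the interval of integration is then empty
    and the integral is zero.\<close>
  have left: "primitive c x = 0" if "x < \<delta>" for x
    unfolding primitive_def using that c0
    by (subst integral_cong[where g = "\<lambda>x. 0"]) auto
  have right: "primitive c x = primitive c y" if "1 - \<delta> < x" "x \<le> y" for x y
  proof -
    have "integral {0..x} c + integral {x..y} c = integral {0..y} c"
      using that \<delta> cont
      by (intro Henstock_Kurzweil_Integration.integral_combine integrable_continuous_real) auto
    moreover have "integral {x..y} c = 0"
      using that c0 by (subst integral_cong[where g = "\<lambda>x. 0"]) auto
    ultimately show ?thesis by (simp add: primitive_def)
  qed
  have "primitive c 1 = 0"
    using primitive_one[OF sq_integrable_compactly_supported[OF c]] mean by simp
  then have zero: "primitive c x = 0" if "x \<notin> {\<delta>..1-\<delta>}" for x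
  proof (cases "x < \<delta>")
    case False
    then have "1 - \<delta> < x" using that by auto
    \<comment> \<open>The point \<open>max x 1\<close> lies to the right of both \<open>x\<close>
      and 1, so constancy compares \<open>x\<close> with 1 in either order.\<close>
    then show ?thesis
      using right[of x "max x 1"] right[of 1 "max x 1"] \<open>primitive c 1 = 0\<close> \<delta> by simp
  qed (rule left)
  have der: "(primitive c has_real_derivative c x) (at x)" for x
  proof (cases "x < \<delta>")
    case True
    have "((\<lambda>x. 0) has_real_derivative 0) (at x)" by simp
    then have "(primitive c has_real_derivative 0) (at x)"
      by (rule has_field_derivative_transform_within_open[where S = "{..<\<delta>}"])
        (simp_all add: True left)
    then show ?thesis using c0[of x] True by simp
  next
    case False
    \<comment> \<open>Since \<open>x\<close> is at least \<delta>, it is interior to this interval,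
      and the derivative within it is a two-sided one.\<close>
    then have x: "x \<in> {0..x+1}" "x \<in> interior {0..x+1}"
      using \<delta> unfolding interior_atLeastAtMost_real by auto
    have "(primitive c has_real_derivative c x) (at x within {0..x+1})"
      unfolding primitive_def[abs_def] by (rule integral_has_real_derivative[OF cont x(1)])
    then show ?thesis
      unfolding at_within_interior[OF x(2)] .
  qed
  show deriv: "deriv (primitive c) = c"
    by (rule ext) (rule DERIV_imp_deriv[OF der])
  show "test_function (primitive c)"
    unfolding test_function_def deriv
  proof (intro conjI cont exI[of _ "{\<delta>..1-\<delta>}"] allI impI)
    show "primitive c differentiable_on UNIV"
      using der unfolding differentiable_on_def by (auto simp: real_differentiable_def)
  qed (use \<delta> zero in auto)
qed

section \<open>Density of compactly supported functions and the Poincare inequality\<close>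


text \<open>Dominated convergence for the squared differences. The majorant is asked of the
  differences, since this is what clamping and truncation supply directly.\<close>

lemma l2_class_tendsto:
  assumes fn: "\<And>n. sq_integrable (f n)" and f: "sq_integrable g"
    and lim: "AE x in unit_leb. (\<lambda>n::nat. f n x) \<longlonglongrightarrow> g x"
    and w: "integrable unit_leb w" and bound: "\<And>n. AE x in unit_leb. (f n x - g x)\<^sup>2 \<le> w x"
  shows "(\<lambda>n. l2_class (f n)) \<longlonglongrightarrow> l2_class g"
proof -
  have "(\<lambda>n. LINT x|unit_leb. (f n x - g x)\<^sup>2) \<longlonglongrightarrow> (LINT x|unit_leb. 0)"
  proof (rule integral_dominated_convergence[where w = w])
    show "AE x in unit_leb. (\<lambda>n. (f n x - g x)\<^sup>2) \<longlonglongrightarrow> 0"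
      using lim
    proof eventually_elim
      case (elim x)
      have "(\<lambda>n. (f n x - g x)\<^sup>2) \<longlonglongrightarrow> (g x - g x)\<^sup>2"
        by (intro tendsto_intros elim)
      then show ?case by simp
    qed
    show "(\<lambda>x. (f n x - g x)\<^sup>2) \<in> borel_measurable unit_leb" for n
      using sq_integrable_diff[OF fn[of n] f] unfolding sq_integrable_def
      by (intro borel_measurable_power) simp
    show "AE x in unit_leb. norm ((f n x - g x)\<^sup>2) \<le> w x" for n
      using bound[of n] by simp
  qed (use w in auto)
  then have "(\<lambda>n. (norm (l2_class (f n) - l2_class g))\<^sup>2) \<longlonglongrightarrow> 0"
    by (simp add: l2_class_diff fn f norm_l2_class sq_integrable_diff)
  then have "(\<lambda>n. sqrt ((norm (l2_class (f n) - l2_class g))\<^sup>2)) \<longlonglongrightarrow> sqrt 0"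
    by (rule tendsto_real_sqrt)
  then have "(\<lambda>n. norm (l2_class (f n) - l2_class g)) \<longlonglongrightarrow> 0"
    by simp
  then show ?thesis
    by (simp add: tendsto_norm_zero_iff LIM_zero_iff)
qed

definition clamp_real :: "real \<Rightarrow> real \<Rightarrow> real" where
  "clamp_real N y = max (- N) (min N y)"

lemma abs_clamp_real_le: "0 \<le> N \<Longrightarrow> \<bar>clamp_real N y\<bar> \<le> N"
  by (auto simp: clamp_real_def)

lemma clamp_real_ident: "\<bar>y\<bar> \<le> N \<Longrightarrow> clamp_real N y = y"
  by (auto simp: clamp_real_def)

lemma continuous_on_clamp_real [continuous_intros]:
  "continuous_on S f \<Longrightarrow> continuous_on S (\<lambda>x. clamp_real N (f x))"
  unfolding clamp_real_def by (intro continuous_intros)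

text \<open>Measurability provides continuous functions converging to \<open>f\<close> off a
  negligible set. Clamping them at \<open>N\<close> keeps the limit, as \<open>f\<close> is bounded
  by \<open>N\<close>, and makes them uniformly bounded; a cutoff moves their supports away from the
  endpoints.\<close>

lemma bounded_in_closure_compactly_supported:
  assumes meas: "f \<in> borel_measurable unit_leb" and bound: "\<And>x. \<bar>f x\<bar> \<le> N"
  shows "l2_class f \<in> closure (l2_class ` Collect compactly_supported)"
proof -
  have "f measurable_on {0<..<1}"
    using meas by (subst measurable_on_iff_borel_measurable) auto
  then obtain M g where M: "negligible M" and g: "\<And>n. continuous_on UNIV (g n)"
    and lim: "\<And>x. x \<notin> M \<Longrightarrow> (\<lambda>n::nat. g n x) \<longlonglongrightarrow> (if x \<in> {0<..<1} then f x else 0)"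
    unfolding measurable_on_def by blast
  have N: "0 \<le> N" using bound[of 0] by simp
  \<comment> \<open>A trapezoid: zero within distance \<open>1 / (n + 3)\<close> of the endpoints
    and one from distance \<open>2 / (n + 3)\<close> on. The 3 keeps the margin below one half for
    every \<open>n\<close>.\<close>
  define cutoff where "cutoff n x = max 0 (min 1 ((real n + 3) * min x (1 - x) - 1))" for n x
  have cutoff: "0 \<le> cutoff n x" "cutoff n x \<le> 1" for n x by (auto simp: cutoff_def)
  define c where "c n x = clamp_real N (g n x) * cutoff n x" for n x
  have cc: "compactly_supported (c n)" for n
    unfolding compactly_supported_def
  proof (intro conjI exI[of _ "1 / (real n + 3)"] allI impI)
    show "continuous_on UNIV (c n)"
      unfolding c_def cutoff_def by (intro continuous_intros g)
    fix x :: real assume "x \<notin> {1 / (real n + 3)..1 - 1 / (real n + 3)}"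
    then have "min x (1 - x) < 1 / (real n + 3)" by auto
    then have "(real n + 3) * min x (1 - x) < 1" by (simp only: less_divide_eq) (simp add: mult.commute)
    then have "cutoff n x = 0" by (simp add: cutoff_def)
    then show "c n x = 0" by (simp add: c_def)
  qed (auto simp: field_simps)
  have c_bound: "\<bar>c n x\<bar> \<le> N" for n x
    using mult_mono[OF abs_clamp_real_le[OF N, of "g n x"] cutoff(2)[of n x]] N cutoff(1)[of n x]
    by (simp add: c_def abs_mult)
  have "(\<lambda>n. l2_class (c n)) \<longlonglongrightarrow> l2_class f"
  proof (rule l2_class_tendsto[where w = "\<lambda>x. (N + N)\<^sup>2"])
    show "sq_integrable (c n)" for n by (rule sq_integrable_compactly_supported[OF cc])
    show "sq_integrable f" using meas bound by (rule sq_integrable_bounded)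
    show "AE x in unit_leb. (c n x - f x)\<^sup>2 \<le> (N + N)\<^sup>2" for n
    proof (intro AE_I2)
      fix x
      have "\<bar>c n x - f x\<bar> \<le> N + N" using c_bound[of n x] bound[of x] by linarith
      then show "(c n x - f x)\<^sup>2 \<le> (N + N)\<^sup>2"
        using power_mono[of "\<bar>c n x - f x\<bar>" "N + N" 2] by simp
    qed
    have "AE x in lebesgue. x \<notin> M"
      using M by (intro AE_not_in) (simp add: negligible_iff_null_sets)
    then have "AE x in unit_leb. x \<notin> M"
      by (subst AE_restrict_space_iff) auto
    then show "AE x in unit_leb. (\<lambda>n. c n x) \<longlonglongrightarrow> f x"
    proof (rule AE_mp, intro AE_I2 impI)
      fix x assume "x \<in> space unit_leb" "x \<notin> M"
      then have x: "0 < x" "x < 1" and lx: "(\<lambda>n. g n x) \<longlonglongrightarrow> f x"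
        using lim[of x] by auto
      have "(\<lambda>n. clamp_real N (g n x)) \<longlonglongrightarrow> clamp_real N (f x)"
        unfolding clamp_real_def by (intro tendsto_intros lx)
      then have 1: "(\<lambda>n. clamp_real N (g n x)) \<longlonglongrightarrow> f x"
        using clamp_real_ident[OF bound] by simp
      have "eventually (\<lambda>n. cutoff n x = 1) sequentially"
      proof -
        define m where "m = min x (1 - x)"
        have m: "0 < m" using x by (simp add: m_def)
        obtain k :: nat where k: "2 / m < real k" using reals_Archimedean2 by blast
        show ?thesis
        proof (rule eventually_sequentiallyI[of k])
          fix n assume "k \<le> n"
          then have "2 / m \<le> real n + 3" using k by simp
          then have "2 \<le> (real n + 3) * m" using m by (simp add: pos_divide_le_eq)
          then show "cutoff n x = 1" unfolding cutoff_def m_def[symmetric] by simp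
        qed
      qed
      then have "(\<lambda>n. cutoff n x) \<longlonglongrightarrow> 1" by (rule tendsto_eventually)
      from tendsto_mult[OF 1 this] show "(\<lambda>n. c n x) \<longlonglongrightarrow> f x"
        by (simp add: c_def)
    qed
  qed simp
  then show ?thesis
    unfolding closure_sequential using cc by (intro exI[of _ "\<lambda>n. l2_class (c n)"]) auto
qed

text \<open>Truncation at height \<open>n\<close> reduces to bounded functions, with
  \<open>f\<close> squared as majorant of the squared error. Closedness of the closure replaces a
  diagonal argument.\<close>

lemma compactly_supported_dense:
  obtains c where "\<And>n. compactly_supported (c n)" "(\<lambda>n::nat. l2_class (c n)) \<longlonglongrightarrow> g"
proof -
  define f where "f = rep_l2 g"
  have f: "sq_integrable f" by (simp add: f_def)
  define f' where "f' n x = clamp_real (real n) (f x)" for n :: nat and x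
  have meas: "f' n \<in> borel_measurable unit_leb" for n
    using f unfolding f'_def clamp_real_def sq_integrable_def by auto
  have bound: "\<bar>f' n x\<bar> \<le> real n" for n x
    unfolding f'_def by (rule abs_clamp_real_le) simp
  have "(\<lambda>n. l2_class (f' n)) \<longlonglongrightarrow> l2_class f"
  proof (rule l2_class_tendsto[where w = "\<lambda>x. (f x)\<^sup>2"])
    show "sq_integrable (f' n)" for n using meas bound by (rule sq_integrable_bounded)
    show "integrable unit_leb (\<lambda>x. (f x)\<^sup>2)" using f by (simp add: sq_integrable_def)
    show "AE x in unit_leb. (f' n x - f x)\<^sup>2 \<le> (f x)\<^sup>2" for n
    proof (intro AE_I2)
      fix x
      have "\<bar>f' n x - f x\<bar> \<le> \<bar>f x\<bar>" by (auto simp: f'_def clamp_real_def)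
      then show "(f' n x - f x)\<^sup>2 \<le> (f x)\<^sup>2" by (simp add: abs_le_square_iff)
    qed
    show "AE x in unit_leb. (\<lambda>n. f' n x) \<longlonglongrightarrow> f x"
    proof (intro AE_I2)
      fix x
      obtain k :: nat where k: "\<bar>f x\<bar> < real k" using reals_Archimedean2 by blast
      show "(\<lambda>n. f' n x) \<longlonglongrightarrow> f x"
      proof (rule tendsto_eventually, rule eventually_sequentiallyI[of k])
        fix n assume "k \<le> n"
        then show "f' n x = f x"
          unfolding f'_def using k by (intro clamp_real_ident) simp
      qed
    qed
  qed (rule f)
  then have "l2_class f \<in> closure (l2_class ` Collect compactly_supported)"
    by (rule closed_sequentially[OF closed_closure, rotated])
      (rule bounded_in_closure_compactly_supported[OF meas bound])
  then obtain h where h: "\<And>n. h n \<in> l2_class ` Collect compactly_supported" and lim: "h \<longlonglongrightarrow> g"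
    unfolding closure_sequential f_def by auto
  from h have "\<forall>n. \<exists>c. compactly_supported c \<and> h n = l2_class c" by blast
  then obtain c where c: "\<And>n. compactly_supported (c n)" "\<And>n. h n = l2_class (c n)" by metis
  then have "h = (\<lambda>n. l2_class (c n))" by blast
  with c lim that show thesis by blast
qed

text \<open>Approximants of the constant one have positive mean eventually, and one of them is
  rescaled. The result serves to correct means to zero without leaving the class.\<close>

lemma compactly_supported_mean_one:
  obtains c where "compactly_supported c" "inner (l2_class c) (l2_class (\<lambda>x. 1)) = 1"
proof -
  let ?one = "l2_class (\<lambda>x. 1)"
  obtain c where c: "\<And>n. compactly_supported (c n)" and lim: "(\<lambda>n::nat. l2_class (c n)) \<longlonglongrightarrow> ?one"
    using compactly_supported_dense by blast
  have "(\<lambda>n. inner (l2_class (c n)) ?one) \<longlonglongrightarrow> inner ?one ?one"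
    by (intro tendsto_intros lim)
  moreover have "inner ?one ?one = 1"
    by (simp add: power2_norm_eq_inner[symmetric])
  ultimately have "eventually (\<lambda>n. 0 < inner (l2_class (c n)) ?one) sequentially"
    by (intro order_tendstoD(1)) auto
  then obtain n where n: "0 < inner (l2_class (c n)) ?one"
    by (auto simp: eventually_sequentially)
  define m where "m = inner (l2_class (c n)) ?one"
  have z: "compactly_supported (\<lambda>x. 0)"
    unfolding compactly_supported_def by (auto intro!: exI[of _ "1/4"])
  \<comment> \<open>The scaling is written as a difference from zero to fit the form of
    \<open>compactly_supported_diff_scale\<close>.\<close>
  have eq: "l2_class (\<lambda>x. 0 - (- 1 / m) * c n x) = (1 / m) *\<^sub>R l2_class (c n)"
    by (simp add: l2_class_scale sq_integrable_compactly_supported[OF c])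
  show thesis
  proof (rule that)
    show "compactly_supported (\<lambda>x. 0 - (- 1 / m) * c n x)"
      by (rule compactly_supported_diff_scale[OF z c])
    show "inner (l2_class (\<lambda>x. 0 - (- 1 / m) * c n x)) ?one = 1"
      unfolding eq using n by (simp add: m_def)
  qed
qed

text \<open>Approximants \<open>c n\<close> of \<open>g\<close> are made mean-free by subtracting
  multiples of one fixed \<open>d\<close>. The multiples are the means of \<open>c n\<close> and
  tend to zero because \<open>g\<close> has mean zero, so the limit is unchanged; the primitives of
  the corrected functions are test functions and converge because taking primitives does not
  increase the norm.\<close>

lemma H10_deriv_primitive:
  assumes g: "sq_integrable g" and mean: "(LINT x|unit_leb. g x) = 0"
  shows "H10_deriv (l2_class (primitive g)) (l2_class g)"
proof -
  let ?one = "l2_class (\<lambda>x. 1)"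
  obtain c where c: "\<And>n. compactly_supported (c n)" and lim: "(\<lambda>n::nat. l2_class (c n)) \<longlonglongrightarrow> l2_class g"
    using compactly_supported_dense by blast
  obtain d where d: "compactly_supported d" and d1: "inner (l2_class d) ?one = 1"
    using compactly_supported_mean_one by blast
  define m where "m n = inner (l2_class (c n)) ?one" for n
  define e where "e n x = c n x - m n * d x" for n x
  have e: "compactly_supported (e n)" for n
    unfolding e_def by (rule compactly_supported_diff_scale[OF c d])
  note sq = sq_integrable_compactly_supported
  have class_e: "l2_class (e n) = l2_class (c n) - m n *\<^sub>R l2_class d" for n
    unfolding e_def by (simp add: l2_class_diff l2_class_scale sq c d sq_integrable_scale)
  have "(LINT x|unit_leb. e n x) = inner (l2_class (e n)) ?one" for n
    using inner_l2_one[OF sq[OF e]] by simp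
  also have "inner (l2_class (e n)) ?one = 0" for n
    by (simp add: class_e inner_diff_left d1 m_def)
  finally have e0: "(LINT x|unit_leb. e n x) = 0" for n .
  have "m \<longlonglongrightarrow> inner (l2_class g) ?one"
    unfolding m_def by (intro tendsto_intros lim)
  then have "m \<longlonglongrightarrow> 0" using mean by (simp add: inner_l2_one g)
  then have "(\<lambda>n. l2_class (e n)) \<longlonglongrightarrow> l2_class g - 0 *\<^sub>R l2_class d"
    unfolding class_e by (intro tendsto_intros lim)
  then have lim_e: "(\<lambda>n. l2_class (e n)) \<longlonglongrightarrow> l2_class g" by simp
  have "(\<lambda>n. l2_class (primitive (e n))) \<longlonglongrightarrow> l2_class (primitive g)"
  proof (rule LIM_zero_cancel, rule Lim_null_comparison)
    show "eventually (\<lambda>n. norm (l2_class (primitive (e n)) - l2_class (primitive g))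
        \<le> norm (l2_class (e n) - l2_class g)) sequentially"
    proof (intro always_eventually allI)
      fix n
      note e' = sq[OF e[of n]]
      have "l2_class (primitive (e n)) - l2_class (primitive g)
          = l2_class (\<lambda>x. primitive (e n) x - primitive g x)"
        by (simp add: l2_class_diff sq_integrable_primitive e' g)
      also have "\<dots> = l2_class (primitive (\<lambda>x. e n x - g x))"
      proof (subst l2_class_eq_iff)
        show "AE x in unit_leb. primitive (e n) x - primitive g x = primitive (\<lambda>x. e n x - g x) x"
          by (intro AE_I2) (simp add: primitive_diff e' g)
      qed (intro sq_integrable_diff sq_integrable_primitive e' g)+
      finally show "norm (l2_class (primitive (e n)) - l2_class (primitive g))
          \<le> norm (l2_class (e n) - l2_class g)"
        using norm_primitive_le[OF sq_integrable_diff[OF e' g]] by (simp add: l2_class_diff e' g)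
    qed
    show "(\<lambda>n. norm (l2_class (e n) - l2_class g)) \<longlonglongrightarrow> 0"
      using lim_e by (simp add: tendsto_norm_zero_iff LIM_zero_iff)
  qed
  then show ?thesis
    unfolding H10_deriv_def using primitive_test_function[OF e e0] lim_e
    by (intro exI[of _ "\<lambda>n. primitive (e n)"]) simp
qed

text \<open>The part of \<open>w\<close> of mean zero has its ordinary primitive, and the mean
  \<open>m\<close> contributes the linear function \<open>m * x\<close>.\<close>

lemma weak_primitive_exists:
  obtains u where "has_weak_deriv u w"
proof -
  let ?f = "rep_l2 w" and ?one = "l2_class (\<lambda>x. 1)"
  define m where "m = (LINT x|unit_leb. ?f x)"
  have g: "sq_integrable (\<lambda>x. ?f x - m)"
    by (intro sq_integrable_diff) auto
  have "(LINT x|unit_leb. ?f x - m) = 0"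
    using sq_integrable_imp_integrable[OF sq_integrable_rep[of w]] by (simp add: m_def)
  then have "has_weak_deriv (l2_class (primitive (\<lambda>x. ?f x - m))) (l2_class (\<lambda>x. ?f x - m))"
    using H10_deriv_imp_has_weak_deriv H10_deriv_primitive[OF g] by blast
  moreover have "l2_class (\<lambda>x. ?f x - m) = w - m *\<^sub>R ?one"
    using l2_class_diff[OF sq_integrable_rep[of w] sq_integrable_const[of m]]
    by (simp add: l2_class_scale)
  ultimately have "has_weak_deriv (l2_class (primitive (\<lambda>x. ?f x - m)) + m *\<^sub>R l2_class (\<lambda>x. x))
      (w - m *\<^sub>R ?one + m *\<^sub>R ?one)"
    using has_weak_deriv_ident has_weak_deriv_scale by (intro has_weak_deriv_add) auto
  then show thesis using that by simp
qed

text \<open>By duality: if \<open>M\<close> is the weighted mean of \<open>u\<close> and \<open>g\<close> is corrected by a multiple of \<open>b\<close> to have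
  mean zero, then pairing \<open>u - M\<close> with \<open>g\<close> amounts to pairing the derivative of \<open>u\<close> with the primitive
  of the corrected \<open>g\<close>, up to sign.\<close>

lemma weighted_Poincare:
  assumes u: "has_weak_deriv u w" and b: "sq_integrable b"
    and b_nonneg: "\<And>x. 0 < x \<Longrightarrow> x < 1 \<Longrightarrow> 0 \<le> b x" and b_one: "(LINT x|unit_leb. b x) = 1"
  shows "norm (u - inner u (l2_class b) *\<^sub>R l2_class (\<lambda>x. 1)) \<le> norm w"
proof -
  let ?one = "l2_class (\<lambda>x. 1)"
  define d where "d = u - inner u (l2_class b) *\<^sub>R ?one"
  define f where "f = rep_l2 d"
  have f: "sq_integrable f" and df: "l2_class f = d" by (simp_all add: f_def)
  define J where "J = (LINT x|unit_leb. f x)"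
  have J: "inner d ?one = J" using inner_l2_one[OF f] by (simp add: J_def df)
  let ?g = "\<lambda>x. f x - J * b x"
  have g: "sq_integrable ?g" by (intro sq_integrable_diff sq_integrable_scale f b)
  have "(LINT x|unit_leb. ?g x) = 0"
    using sq_integrable_imp_integrable[OF f] sq_integrable_imp_integrable[OF b] b_one
    by (simp add: J_def)
  from H10_deriv_inner[OF H10_deriv_primitive[OF g this] u]
  have "inner u (l2_class ?g) = - inner w (l2_class (primitive ?g))" .
  moreover have "l2_class ?g = d - J *\<^sub>R l2_class b"
    by (simp add: l2_class_diff[symmetric] l2_class_scale[symmetric] f b sq_integrable_scale df)
  moreover have "inner u (d - J *\<^sub>R l2_class b) = inner d d"
  proof -
    have "inner d d = inner (u - inner u (l2_class b) *\<^sub>R ?one) d" by (simp only: d_def)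
    also have "\<dots> = inner u d - inner u (l2_class b) * J"
      using J by (simp only: inner_diff_left inner_scaleR_left inner_commute[of ?one d])
    finally show ?thesis by (simp only: inner_diff_right inner_scaleR_right mult.commute)
  qed
  ultimately have "(norm d)\<^sup>2 = - inner w (l2_class (primitive ?g))"
    by (simp add: power2_norm_eq_inner)
  also have "\<dots> \<le> norm w * norm (l2_class (primitive ?g))"
    using norm_cauchy_schwarz[of "- w"] by simp
  also have "\<dots> \<le> norm w * norm d"
    using norm_primitive_mean_corrected_le[OF f b b_nonneg b_one]
    by (intro mult_left_mono) (auto simp: df J_def)
  finally have "norm d * norm d \<le> norm w * norm d" by (simp add: power2_eq_square)
  then have "norm d \<le> norm w" by (cases "norm d = 0") auto
  then show ?thesis by (simp add: d_def)
qed

section \<open>The energy identity for mild solutions\<close>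


lemma has_vector_derivative_quotient_tendsto:
  fixes f :: "real \<Rightarrow> 'a::real_normed_vector"
  assumes "(f has_vector_derivative f') (at x within S)"
  shows "((\<lambda>y. (1 / (y - x)) *\<^sub>R (f y - f x)) \<longlongrightarrow> f') (at x within S)"
proof (rule LIM_zero_cancel, rule tendsto_norm_zero_cancel)
  have "((\<lambda>y. (1 / norm (y - x)) *\<^sub>R (f y - (f x + (y - x) *\<^sub>R f'))) \<longlongrightarrow> 0) (at x within S)"
    using assms unfolding has_vector_derivative_def has_derivative_within by blast
  then have lim: "((\<lambda>y. norm ((1 / norm (y - x)) *\<^sub>R (f y - (f x + (y - x) *\<^sub>R f')))) \<longlongrightarrow> 0) (at x within S)"
    by (rule tendsto_norm_zero)
  \<comment> \<open>The two scalings differ only by the sign of \<open>y - x\<close>, which the norm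
    does not see.\<close>
  have eq: "norm ((1 / norm (y - x)) *\<^sub>R (f y - (f x + (y - x) *\<^sub>R f')))
      = norm ((1 / (y - x)) *\<^sub>R (f y - f x) - f')" if "y \<noteq> x" for y
  proof -
    have "(1 / (y - x)) *\<^sub>R (f y - f x) - f' = (1 / (y - x)) *\<^sub>R (f y - (f x + (y - x) *\<^sub>R f'))"
      using that by (simp add: scaleR_diff_right scaleR_add_right)
    then show ?thesis by simp
  qed
  show "((\<lambda>y. norm ((1 / (y - x)) *\<^sub>R (f y - f x) - f')) \<longlongrightarrow> 0) (at x within S)"
    by (rule Lim_transform_eventually[OF lim], simp only: eventually_at_filter)
      (intro always_eventually allI impI eq)
qed

text \<open>The fundamental theorem of calculus without completeness of the target space: the
  increments are estimated after pairing with a fixed vector.\<close>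

lemma has_vector_derivative_of_integrals:
  fixes w :: "real \<Rightarrow> 'a::real_inner"
  assumes cont: "continuous_on {0..T} w"
    and int: "\<And>t. t \<in> {0..T} \<Longrightarrow> (w has_integral Z t) {0..t}"
    and t: "t \<in> {0..T}"
  shows "(Z has_vector_derivative w t) (at t within {0..T})"
  unfolding has_vector_derivative_def has_derivative_within_alt
proof (intro conjI allI impI)
  show "bounded_linear (\<lambda>x. x *\<^sub>R w t)" by (rule bounded_linear_scaleR_left)
  fix e :: real assume "0 < e"
  then obtain d where d: "0 < d" and wd: "\<And>r. r \<in> {0..T} \<Longrightarrow> dist r t < d \<Longrightarrow> dist (w r) (w t) < e"
    using cont t unfolding continuous_on_iff by blast
  have "norm (Z y - Z t - (y - t) *\<^sub>R w t) \<le> e * norm (y - t)"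
    if y: "y \<in> {0..T}" "norm (y - t) < d" for y
  proof -
    \<comment> \<open>The remainder is paired with itself: the increment of \<phi> becomes the
      square of its norm, and one factor cancels at the end.\<close>
    define V where "V = Z y - Z t - (y - t) *\<^sub>R w t"
    define \<phi> where "\<phi> r = inner (Z r) V - r * inner (w t) V" for r
    have der: "((\<lambda>r. inner (Z r) V) has_real_derivative inner (w r) V) (at r within {0..T})"
      if r: "r \<in> {0..T}" for r
    proof -
      \<comment> \<open>A bounded functional commutes with the integral, which leaves the
        real-valued fundamental theorem.\<close>
      have eq: "inner (Z x) V = integral {0..x} (\<lambda>x. inner (w x) V)" if "x \<in> {0..T}" for x
        using has_integral_linear[OF int[OF that] bounded_linear_inner_left[of V]]
        by (simp add: o_def integral_unique)
      have "((\<lambda>x. integral {0..x} (\<lambda>x. inner (w x) V)) has_vector_derivative inner (w r) V) (at r within {0..T})"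
        by (intro integral_has_vector_derivative continuous_intros cont r)
      from has_vector_derivative_transform[OF r eq this] show ?thesis
        by (simp add: has_real_derivative_iff_has_vector_derivative)
    qed
    have "norm (\<phi> y - \<phi> t) \<le> (e * norm V) * norm (y - t)"
    proof (rule field_differentiable_bound[where S = "{0..T} \<inter> ball t d" and f' = "\<lambda>r. inner (w r - w t) V"])
      show "convex ({0..T} \<inter> ball t d)" by (intro convex_Int convex_ball) simp
      fix r assume r: "r \<in> {0..T} \<inter> ball t d"
      then have "(\<phi> has_real_derivative inner (w r) V - 1 * inner (w t) V) (at r within {0..T})"
        unfolding \<phi>_def by (intro DERIV_diff der DERIV_cmult_right[OF DERIV_ident]) auto
      then show "(\<phi> has_real_derivative inner (w r - w t) V) (at r within {0..T} \<inter> ball t d)"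
        by (auto simp: inner_diff_left intro: has_field_derivative_subset)
      have "norm (inner (w r - w t) V) \<le> norm (w r - w t) * norm V"
        using Cauchy_Schwarz_ineq2 by auto
      also have "\<dots> \<le> e * norm V"
        using wd[of r] r by (intro mult_right_mono) (auto simp: dist_norm abs_minus_commute)
      finally show "norm (inner (w r - w t) V) \<le> e * norm V" .
    qed (use y t d in \<open>auto simp: dist_norm norm_minus_commute\<close>)
    moreover have "\<phi> y - \<phi> t = inner V V"
    proof -
      have "inner V V = inner (Z y - Z t - (y - t) *\<^sub>R w t) V" by (simp only: V_def)
      then show ?thesis by (simp add: \<phi>_def inner_diff_left algebra_simps)
    qed
    ultimately have "norm V * norm V \<le> (e * norm (y - t)) * norm V"
      by (simp add: power2_norm_eq_inner[symmetric] power2_eq_square mult_ac)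
    then have "norm V \<le> e * norm (y - t)"
      using \<open>0 < e\<close> by (cases "norm V = 0") auto
    then show ?thesis by (simp add: V_def)
  qed
  then show "\<exists>d>0. \<forall>y\<in>{0..T}. norm (y - t) < d \<longrightarrow>
      norm (Z y - Z t - (y - t) *\<^sub>R w t) \<le> e * norm (y - t)"
    using d by blast
qed

lemma norm_increment_le:
  fixes f :: "real \<Rightarrow> 'a::real_normed_vector"
  assumes "convex S" "\<And>x. x \<in> S \<Longrightarrow> (f has_vector_derivative f' x) (at x within S)"
    and "\<And>x. x \<in> S \<Longrightarrow> norm (f' x) \<le> B" and "x \<in> S" "y \<in> S"
  shows "norm (f y - f x) \<le> B * \<bar>y - x\<bar>"
proof -
  have "norm (f y - f x) \<le> B * norm (y - x)"
  proof (rule differentiable_bound[OF assms(1), where f' = "\<lambda>x r. r *\<^sub>R f' x"])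
    show "(f has_derivative (\<lambda>r. r *\<^sub>R f' z)) (at z within S)" if "z \<in> S" for z
      using assms(2)[OF that] by (simp add: has_vector_derivative_def)
    show "onorm (\<lambda>r. r *\<^sub>R f' z) \<le> B" if "z \<in> S" for z
    proof (rule onorm_le)
      show "norm (r *\<^sub>R f' z) \<le> B * norm r" for r
        using mult_left_mono[OF assms(3)[OF that], of "\<bar>r\<bar>"] by (simp add: mult.commute)
    qed
  qed (use assms in auto)
  then show ?thesis by simp
qed

lemma has_vector_derivative_increment:
  fixes Z :: "real \<Rightarrow> 'a::real_normed_vector"
  assumes Z: "\<And>t. t \<in> {0..T} \<Longrightarrow> (Z has_vector_derivative w t) (at t within {0..T})"
    and h: "0 \<le> h" and t: "t \<in> {0..T - h}"
  shows "((\<lambda>t. Z (t + h) - Z t) has_vector_derivative (w (t + h) - w t)) (at t within {0..T - h})"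
proof (rule has_vector_derivative_diff)
  have "((\<lambda>t. t + h) has_vector_derivative 1) (at t within {0..T - h})"
    by (auto intro!: derivative_eq_intros)
  moreover have "(Z has_vector_derivative w (t + h)) (at (t + h) within (\<lambda>t. t + h) ` {0..T - h})"
    using t h by (intro has_vector_derivative_within_subset[OF Z]) auto
  ultimately show "((\<lambda>t. Z (t + h)) has_vector_derivative w (t + h)) (at t within {0..T - h})"
    using vector_diff_chain_within by (force simp: o_def)
  show "(Z has_vector_derivative w t) (at t within {0..T - h})"
    using t h by (intro has_vector_derivative_within_subset[OF Z]) auto
qed

lemma has_real_derivative_norm_sq:
  fixes f :: "real \<Rightarrow> 'a::real_inner"
  assumes "(f has_vector_derivative f') (at t within S)"
  shows "((\<lambda>t. (norm (f t))\<^sup>2) has_real_derivative 2 * inner (f t) f') (at t within S)"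
proof -
  have "((\<lambda>t. inner (f t) (f t)) has_derivative (\<lambda>h. inner (f t) (h *\<^sub>R f') + inner (h *\<^sub>R f') (f t))) (at t within S)"
    using assms unfolding has_vector_derivative_def by (intro has_derivative_inner)
  moreover have "(\<lambda>h. inner (f t) (h *\<^sub>R f') + inner (h *\<^sub>R f') (f t)) = (*) (2 * inner (f t) f')"
    by (auto simp: fun_eq_iff inner_commute)
  ultimately show ?thesis
    by (simp only: power2_norm_eq_inner has_field_derivative_def)
qed

text \<open>The integrated equations of a mild solution in relational form: \<open>w1\<close> and
  \<open>r2\<close> are space derivatives of the time integrals \<open>Z1\<close> and
  \<open>Z2\<close>.\<close>

locale mild_damped = damping +
  fixes T :: real and v q Z1 Z2 w1 r2 :: "real \<Rightarrow> l2"
  assumes T_pos: "0 < T"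
    and cont_v: "continuous_on {0..T} v" and cont_q: "continuous_on {0..T} q"
    and deriv_Z1: "\<And>t. t \<in> {0..T} \<Longrightarrow> (Z1 has_vector_derivative v t) (at t within {0..T})"
    and deriv_Z2: "\<And>t. t \<in> {0..T} \<Longrightarrow> (Z2 has_vector_derivative q t) (at t within {0..T})"
    and weak_Z1: "\<And>t. t \<in> {0..T} \<Longrightarrow> has_weak_deriv (Z1 t) (w1 t)"
    and weak_Z2: "\<And>t. t \<in> {0..T} \<Longrightarrow> H10_deriv (Z2 t) (r2 t)"
    and eq_v: "\<And>t. t \<in> {0..T} \<Longrightarrow> v t = v 0 - r2 t - l2_mult a (Z1 t)"
    and eq_q: "\<And>t. t \<in> {0..T} \<Longrightarrow> q t = q 0 - w1 t"
begin

lemma l2_mult_diff: "l2_mult a (x - y) = l2_mult a x - l2_mult a y"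
  by (rule linear_diff[OF bounded_linear.linear[OF bounded_linear_l2_mult]])

lemma H10_deriv_increment_inner:
  assumes "x \<in> {0..T}" "y \<in> {0..T}" "has_weak_deriv z w"
  shows "inner (r2 x - r2 y) z = - inner w (Z2 x - Z2 y)"
  using H10_deriv_inner[OF weak_Z2[OF assms(1)] assms(3)] H10_deriv_inner[OF weak_Z2[OF assms(2)] assms(3)]
  by (simp add: inner_diff_left inner_diff_right inner_commute)

definition dissipation :: "real \<Rightarrow> real" where
  "dissipation t = inner (l2_mult a (v t)) (v t)"

lemma continuous_dissipation: "continuous_on {0..T} dissipation"
  unfolding dissipation_def
  by (intro continuous_intros cont_v bounded_linear.continuous_on[OF bounded_linear_l2_mult])

text \<open>Twice the energy of order zero.\<close>

definition sq_norm :: "real \<Rightarrow> real" where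
  "sq_norm t = (norm (v t))\<^sup>2 + (norm (q t))\<^sup>2"

lemma continuous_sq_norm: "continuous_on {0..T} sq_norm"
  unfolding sq_norm_def by (intro continuous_intros cont_v cont_q)

text \<open>Increments of the time integrals form a classical solution: the constants
  \<open>v 0\<close> and \<open>q 0\<close> cancel, and the time derivatives are increments of
  \<open>v\<close> and \<open>q\<close>. In the derivative of the squared norms the two space
  derivative terms cancel through \<open>H10_deriv_increment_inner\<close>, leaving only the
  damping.\<close>

lemma increment_identity:
  assumes h: "0 < h" and st: "0 \<le> s" "s \<le> t" "t + h \<le> T"
  shows "((\<lambda>r. - 2 * inner (l2_mult a (Z1 (r + h) - Z1 r)) (Z1 (r + h) - Z1 r)) has_integral
    ((norm (Z1 (t + h) - Z1 t))\<^sup>2 + (norm (Z2 (t + h) - Z2 t))\<^sup>2)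
    - ((norm (Z1 (s + h) - Z1 s))\<^sup>2 + (norm (Z2 (s + h) - Z2 s))\<^sup>2)) {s..t}"
proof (rule fundamental_theorem_of_calculus[OF st(2)])
  fix r assume r: "r \<in> {s..t}"
  then have r': "r \<in> {0..T - h}" "r \<in> {0..T}" "r + h \<in> {0..T}" and sub: "{s..t} \<subseteq> {0..T - h}"
    using h st by auto
  have 1: "((\<lambda>t. Z1 (t + h) - Z1 t) has_vector_derivative (v (r + h) - v r)) (at r within {s..t})"
    and 2: "((\<lambda>t. Z2 (t + h) - Z2 t) has_vector_derivative (q (r + h) - q r)) (at r within {s..t})"
    using has_vector_derivative_increment[OF deriv_Z1 less_imp_le[OF h] r'(1)]
      has_vector_derivative_increment[OF deriv_Z2 less_imp_le[OF h] r'(1)]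
      has_vector_derivative_within_subset[OF _ sub] by blast+
  have "((\<lambda>t. (norm (Z1 (t + h) - Z1 t))\<^sup>2 + (norm (Z2 (t + h) - Z2 t))\<^sup>2) has_real_derivative
     2 * inner (Z1 (r + h) - Z1 r) (v (r + h) - v r) + 2 * inner (Z2 (r + h) - Z2 r) (q (r + h) - q r))
     (at r within {s..t})"
    by (intro DERIV_add has_real_derivative_norm_sq 1 2)
  moreover have "2 * inner (Z1 (r + h) - Z1 r) (v (r + h) - v r) + 2 * inner (Z2 (r + h) - Z2 r) (q (r + h) - q r)
      = - 2 * inner (l2_mult a (Z1 (r + h) - Z1 r)) (Z1 (r + h) - Z1 r)"
  proof -
    have "v (r + h) - v r = - (r2 (r + h) - r2 r) - l2_mult a (Z1 (r + h) - Z1 r)"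
      using eq_v[OF r'(3)] eq_v[OF r'(2)] by (simp add: l2_mult_diff)
    moreover have "q (r + h) - q r = - (w1 (r + h) - w1 r)"
      using eq_q[OF r'(3)] eq_q[OF r'(2)] by simp
    moreover have "inner (r2 (r + h) - r2 r) (Z1 (r + h) - Z1 r) = - inner (w1 (r + h) - w1 r) (Z2 (r + h) - Z2 r)"
      by (intro H10_deriv_increment_inner has_weak_deriv_diff weak_Z1 r')
    ultimately show ?thesis
      by (simp only: inner_diff_right[of _ "- _"] inner_minus_right inner_commute[of "Z1 _ - _"] inner_commute[of "Z2 _ - _"]) simp
  qed
  ultimately show "((\<lambda>t. (norm (Z1 (t + h) - Z1 t))\<^sup>2 + (norm (Z2 (t + h) - Z2 t))\<^sup>2) has_vector_derivative
      - 2 * inner (l2_mult a (Z1 (r + h) - Z1 r)) (Z1 (r + h) - Z1 r)) (at r within {s..t})"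
    by (simp add: has_real_derivative_iff_has_vector_derivative)
qed

text \<open>The increment identity is quadratic, so dividing by the squared step turns it into one
  for difference quotients. These converge to \<open>v\<close> and \<open>q\<close>, and the bound
  on \<open>v\<close> gives a constant majorant for the dissipation integral. Having
  \<open>t < T\<close> leaves room for forward quotients.\<close>

lemma energy_identity_interior:
  assumes st: "0 \<le> s" "s \<le> t" "t < T"
  shows "sq_norm t - sq_norm s = - 2 * integral {s..t} dissipation"
proof -
  \<comment> \<open>These steps never exceed \<open>T - t\<close>, so all quotients on
    \<open>{s..t}\<close> stay within the time interval.\<close>
  define h where "h n = (T - t) / (real n + 1)" for n
  have h: "0 < h n" "t + h n \<le> T" for n
  proof -
    show "0 < h n" using st by (simp add: h_def)
    have "h n \<le> (T - t) / 1" unfolding h_def using st by (intro divide_left_mono) auto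
    then show "t + h n \<le> T" by simp
  qed
  have h0: "h \<longlonglongrightarrow> 0"
    unfolding h_def using tendsto_mult_right_zero[OF LIMSEQ_inverse_real_of_nat, of "T - t"]
    by (simp add: divide_inverse add.commute)
  define d1 d2 where "d1 n r = (1 / h n) *\<^sub>R (Z1 (r + h n) - Z1 r)"
    and "d2 n r = (1 / h n) *\<^sub>R (Z2 (r + h n) - Z2 r)" for n r
  have lim: "(\<lambda>n. d1 n r) \<longlonglongrightarrow> v r" "(\<lambda>n. d2 n r) \<longlonglongrightarrow> q r" if r: "r \<in> {s..t}" for r
  proof -
    have rT: "r \<in> {0..T}" using r st by auto
    have "r + h n \<in> {0..T}" for n using r st h[of n] by auto
    then have "filterlim (\<lambda>n. r + h n) (at r within {0..T}) sequentially"
      using tendsto_add[OF tendsto_const h0, of r] h(1)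
      by (auto simp: filterlim_at intro!: always_eventually) (metis less_irrefl)
    from filterlim_compose[OF has_vector_derivative_quotient_tendsto[OF deriv_Z1[OF rT]] this]
      filterlim_compose[OF has_vector_derivative_quotient_tendsto[OF deriv_Z2[OF rT]] this]
    show "(\<lambda>n. d1 n r) \<longlonglongrightarrow> v r" "(\<lambda>n. d2 n r) \<longlonglongrightarrow> q r"
      by (simp_all add: d1_def d2_def)
  qed
  have "bounded (v ` {0..T})"
    by (intro compact_imp_bounded compact_continuous_image cont_v) simp
  then obtain C where C: "\<forall>r\<in>{0..T}. norm (v r) \<le> C" unfolding bounded_iff by auto
  have d1_bound: "norm (d1 n r) \<le> C" if r: "r \<in> {s..t}" for n r
  proof -
    have "norm (Z1 (r + h n) - Z1 r) \<le> C * \<bar>r + h n - r\<bar>"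
      by (rule norm_increment_le[of "{0..T}" Z1 v]) (use deriv_Z1 C r st h[of n] in auto)
    then have "norm (Z1 (r + h n) - Z1 r) \<le> C * h n" using h(1)[of n] by simp
    then show ?thesis using h(1)[of n] by (simp add: d1_def pos_divide_le_eq)
  qed
  have sq: "- 2 * inner (l2_mult a (d1 n r)) (d1 n r)
        = (1 / h n)\<^sup>2 * (- 2 * inner (l2_mult a (Z1 (r + h n) - Z1 r)) (Z1 (r + h n) - Z1 r))"
      "(norm (d1 n r))\<^sup>2 = (1 / h n)\<^sup>2 * (norm (Z1 (r + h n) - Z1 r))\<^sup>2"
      "(norm (d2 n r))\<^sup>2 = (1 / h n)\<^sup>2 * (norm (Z2 (r + h n) - Z2 r))\<^sup>2" for n r
    by (simp_all only: d1_def d2_def norm_scaleR power_mult_distrib power2_abs l2_mult_scale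
        inner_scaleR_left inner_scaleR_right power2_eq_square mult_ac)
  have int: "((\<lambda>r. - 2 * inner (l2_mult a (d1 n r)) (d1 n r)) has_integral
      ((norm (d1 n t))\<^sup>2 + (norm (d2 n t))\<^sup>2) - ((norm (d1 n s))\<^sup>2 + (norm (d2 n s))\<^sup>2)) {s..t}" for n
    using has_integral_mult_right[OF increment_identity[OF h(1) st(1,2) h(2)], of "(1 / h n)\<^sup>2" n]
    unfolding sq by (simp only: right_diff_distrib distrib_left)
  have conv: "(\<lambda>n. integral {s..t} (\<lambda>r. - 2 * inner (l2_mult a (d1 n r)) (d1 n r)))
      \<longlonglongrightarrow> integral {s..t} (\<lambda>r. - 2 * dissipation r)"
  proof (rule dominated_convergence[where h = "\<lambda>r. 2 * (a1 * C * C)"])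
    show "norm (- 2 * inner (l2_mult a (d1 n r)) (d1 n r)) \<le> 2 * (a1 * C * C)" if r: "r \<in> {s..t}" for n r
    proof -
      have "\<bar>inner (l2_mult a (d1 n r)) (d1 n r)\<bar> \<le> norm (l2_mult a (d1 n r)) * norm (d1 n r)"
        by (rule Cauchy_Schwarz_ineq2)
      also have "\<dots> \<le> (a1 * C) * C"
      proof (rule mult_mono)
        have "norm (l2_mult a (d1 n r)) \<le> a1 * norm (d1 n r)" by (rule norm_l2_mult_le)
        also have "\<dots> \<le> a1 * C" using d1_bound[OF r] a1_pos by (intro mult_left_mono) auto
        finally show "norm (l2_mult a (d1 n r)) \<le> a1 * C" .
        show "0 \<le> a1 * C" using order_trans[OF norm_ge_zero d1_bound[OF r, of n]] a1_pos by simp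
      qed (use d1_bound[OF r] in auto)
      finally show ?thesis by (simp add: abs_mult)
    qed
    show "(\<lambda>n. - 2 * inner (l2_mult a (d1 n r)) (d1 n r)) \<longlonglongrightarrow> - 2 * dissipation r" if "r \<in> {s..t}" for r
      unfolding dissipation_def
      by (intro tendsto_intros bounded_linear.tendsto[OF bounded_linear_l2_mult] lim that)
  qed (use int in \<open>auto intro: has_integral_integrable\<close>)
  moreover have "(\<lambda>n. ((norm (d1 n t))\<^sup>2 + (norm (d2 n t))\<^sup>2) - ((norm (d1 n s))\<^sup>2 + (norm (d2 n s))\<^sup>2))
      \<longlonglongrightarrow> sq_norm t - sq_norm s"
    unfolding sq_norm_def by (intro tendsto_intros lim) (use st in auto)
  ultimately have "integral {s..t} (\<lambda>r. - 2 * dissipation r) = sq_norm t - sq_norm s"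
    using integral_unique[OF int] by (auto intro: LIMSEQ_unique)
  then show ?thesis by simp
qed

lemma energy_derivative:
  assumes t: "t \<in> {0..T}"
  shows "(sq_norm has_real_derivative - 2 * dissipation t) (at t within {0..T})"
proof -
  have cont: "continuous_on {0..T} (\<lambda>x. integral {0..x} dissipation)"
    by (intro indefinite_integral_continuous_1 integrable_continuous_real continuous_dissipation)
  have eq: "sq_norm x = sq_norm 0 - 2 * integral {0..x} dissipation" if "x \<in> {0..T}" for x
  proof -
    have "sq_norm x + 2 * integral {0..x} dissipation = sq_norm 0"
    \<comment> \<open>The integrated identity is known before time \<open>T\<close> only; continuity
      of both terms carries it to the endpoint.\<close>
    proof (rule continuous_constant_on_closure[where S = "{0..<T}" and f = "\<lambda>x. sq_norm x + 2 * integral {0..x} dissipation"])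
      show "sq_norm x + 2 * integral {0..x} dissipation = sq_norm 0" if "x \<in> {0..<T}" for x
        using energy_identity_interior[of 0 x] that by simp
      show "continuous_on (closure {0..<T}) (\<lambda>x. sq_norm x + 2 * integral {0..x} dissipation)"
        using T_pos cont continuous_sq_norm by (auto intro!: continuous_intros)
    qed (use that T_pos in auto)
    then show ?thesis by simp
  qed
  have "((\<lambda>x. integral {0..x} dissipation) has_real_derivative dissipation t) (at t within {0..T})"
    by (rule integral_has_real_derivative[OF continuous_dissipation t])
  from DERIV_diff[OF DERIV_const DERIV_cmult[OF this, of 2], of "sq_norm 0"]
  have "((\<lambda>x. sq_norm 0 - 2 * integral {0..x} dissipation) has_real_derivative - 2 * dissipation t) (at t within {0..T})"
    by simp
  then have "((\<lambda>x. sq_norm 0 - 2 * integral {0..x} dissipation) has_vector_derivative - 2 * dissipation t) (at t within {0..T})"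
    by (simp only: has_real_derivative_iff_has_vector_derivative)
  from has_vector_derivative_transform[where g = sq_norm, OF t eq this] show ?thesis
    by (simp only: has_real_derivative_iff_has_vector_derivative)
qed

end

section \<open>The Lyapunov functional\<close>


context damping
begin

text \<open>The two inequalities of \<open>rate_bounds\<close> ask for \<open>rate\<close> to be at
  most \<open>2 * a0 ^ 3\<close> over \<open>8 * a0\<^sup>2 + 4 * a0 ^ 3\<close> and over
  \<open>3 * a0\<^sup>2 + a0\<^sup>2 * a1\<^sup>2 + 2 * a0 * a1\<close>. The denominator here bounds
  both from above. Two thirds of \<open>rate\<close> is the decay rate of the theorem.\<close>

definition rate :: real where
  "rate = 2 * a0 ^ 3 / (8 * a0\<^sup>2 + 4 * a0\<^sup>2 * a1 + 2 * a0 * a1 + a1 ^ 4)"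

lemma rate_pos: "0 < rate"
  unfolding rate_def using a0_pos a1_pos by (intro divide_pos_pos add_pos_pos) auto

text \<open>The first bound makes the functional comparable to the energy; the second lets the
  damping absorb the cross terms.\<close>

lemma rate_bounds:
  shows "rate * (1 / a0 + 1 / 2) \<le> 1 / 4"
    and "rate * (3 + a1\<^sup>2 + 2 * a1 / a0) \<le> 2 * a0"
proof -
  define D where "D = 8 * a0\<^sup>2 + 4 * a0\<^sup>2 * a1 + 2 * a0 * a1 + a1 ^ 4"
  note pos = a0_pos a1_pos a0_le_a1
  have D: "0 < D" unfolding D_def using pos by (intro add_pos_pos) auto
  have rate: "rate * D = 2 * a0 ^ 3" unfolding rate_def D_def[symmetric] using D by simp
  have "8 * a0\<^sup>2 + 4 * a0\<^sup>2 * a0 \<le> D"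
  proof -
    have "4 * a0\<^sup>2 * a0 \<le> 4 * a0\<^sup>2 * a1" using pos by (intro mult_left_mono) auto
    moreover have "0 \<le> 2 * a0 * a1 + a1 ^ 4" using pos by simp
    ultimately show ?thesis unfolding D_def by linarith
  qed
  from mult_left_mono[OF this, of rate] have "rate * (8 * a0\<^sup>2 + 4 * a0\<^sup>2 * a0) \<le> 2 * a0 ^ 3"
    using rate_pos rate by simp
  then have "(rate * (2 + a0)) * (4 * a0\<^sup>2) \<le> (a0 / 2) * (4 * a0\<^sup>2)"
    by (simp add: algebra_simps power2_eq_square power3_eq_cube)
  then have 1: "rate * (2 + a0) \<le> a0 / 2" using pos by (subst (asm) mult_le_cancel_right_pos) auto
  have "rate * (1 / a0 + 1 / 2) = rate * (2 + a0) / (2 * a0)" using pos by (simp add: field_simps)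
  also have "\<dots> \<le> 1 / 4" using 1 pos by (simp add: pos_divide_le_eq)
  finally show "rate * (1 / a0 + 1 / 2) \<le> 1 / 4" .
  have "a0\<^sup>2 * a1\<^sup>2 \<le> a1\<^sup>2 * a1\<^sup>2" using pos by (intro mult_right_mono power_mono) auto
  then have "a0\<^sup>2 * a1\<^sup>2 \<le> a1 ^ 4" by (simp add: power2_eq_square power4_eq_xxxx mult.assoc)
  moreover have "0 \<le> 5 * a0\<^sup>2 + 4 * a0\<^sup>2 * a1" using pos by simp
  ultimately have "3 * a0\<^sup>2 + a0\<^sup>2 * a1\<^sup>2 + 2 * a0 * a1 \<le> D" unfolding D_def by linarith
  from mult_left_mono[OF this, of rate]
  have "rate * (3 * a0\<^sup>2 + a0\<^sup>2 * a1\<^sup>2 + 2 * a0 * a1) \<le> 2 * a0 ^ 3"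
    using rate_pos rate by simp
  then have "(rate * (3 + a1\<^sup>2 + 2 * a1 / a0)) * a0\<^sup>2 \<le> (2 * a0) * a0\<^sup>2"
    using pos by (simp add: algebra_simps power2_eq_square power3_eq_cube)
  then show "rate * (3 + a1\<^sup>2 + 2 * a1 / a0) \<le> 2 * a0"
    using pos by (subst (asm) mult_le_cancel_right_pos) auto
qed

text \<open>Here \<open>x\<close> and \<open>y\<close> stand for the norms of \<open>v\<close> and
  \<open>q\<close>, and \<open>y + x / a0\<close> for the bound on the norm of
  \<open>U\<close>.\<close>

lemma cross_term_le:
  assumes "0 \<le> x" "0 \<le> y"
  shows "rate * (x * (y + x / a0)) \<le> (x\<^sup>2 + y\<^sup>2) / 4"
proof -
  have "x * y \<le> (x\<^sup>2 + y\<^sup>2) / 2" using sum_squares_bound[of x y] by simp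
  then have "x * (y + x / a0) \<le> x\<^sup>2 * (1 / a0 + 1 / 2) + y\<^sup>2 * (1 / 2)"
    by (simp add: power2_eq_square algebra_simps)
  then have "rate * (x * (y + x / a0)) \<le> rate * (x\<^sup>2 * (1 / a0 + 1 / 2) + y\<^sup>2 * (1 / 2))"
    using rate_pos by (intro mult_left_mono) auto
  also have "\<dots> = x\<^sup>2 * (rate * (1 / a0 + 1 / 2)) + y\<^sup>2 * (rate * (1 / 2))"
    by (simp add: algebra_simps)
  also have "\<dots> \<le> x\<^sup>2 * (1 / 4) + y\<^sup>2 * (1 / 4)"
  proof (intro add_mono mult_left_mono rate_bounds)
    have "0 \<le> rate * (1 / a0)" using rate_pos a0_pos by simp
    with rate_bounds(1) show "rate * (1 / 2) \<le> 1 / 4" unfolding distrib_left by linarith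
  qed auto
  finally show ?thesis by (simp only: add_divide_distrib)
qed

text \<open>Completing the square in \<open>y\<close> absorbs the mixed term
  \<open>a1 * x * y\<close>. What remains is a multiple of the square of \<open>x\<close>, with
  nonnegative coefficient by the second bound on \<open>rate\<close>; \<kappa> stands for the
  dissipation.\<close>

lemma dissipation_rate_le:
  assumes "a0 * x\<^sup>2 \<le> \<kappa>"
  shows "- \<kappa> + rate * (x\<^sup>2 - y\<^sup>2 + a1 * (x * (y + x / a0))) \<le> - rate * ((x\<^sup>2 + y\<^sup>2) / 2)"
proof -
  have eq: "a0 * x\<^sup>2 - rate * (x\<^sup>2 - y\<^sup>2 + a1 * (x * (y + x / a0))) - rate * ((x\<^sup>2 + y\<^sup>2) / 2)
      = rate / 2 * (y - a1 * x)\<^sup>2 + x\<^sup>2 / 2 * (2 * a0 - rate * (3 + a1\<^sup>2 + 2 * a1 / a0))"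
    using a0_pos by (simp add: field_simps power2_eq_square)
  have "0 \<le> rate / 2 * (y - a1 * x)\<^sup>2 + x\<^sup>2 / 2 * (2 * a0 - rate * (3 + a1\<^sup>2 + 2 * a1 / a0))"
    using rate_pos rate_bounds(2) by (intro add_nonneg_nonneg mult_nonneg_nonneg) auto
  then show ?thesis unfolding eq[symmetric] using assms by simp
qed

end

section \<open>The normalised potential\<close>

context mild_damped
begin

text \<open>Adding a constant keeps the weak derivative and shifts the pairing with \<open>a\<close>
  by that constant times the integral of \<open>a\<close>, which is at least \<open>a0\<close>. So
  any prescribed value can be reached.\<close>

lemma stationary_potential_exists:
  obtains u where "has_weak_deriv u (- q 0)"
    "inner u (l2_class a) = - inner (v 0) (l2_class (\<lambda>x. 1))"
proof -
  let ?one = "l2_class (\<lambda>x. 1)"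
  obtain u0 where u0: "has_weak_deriv u0 (- q 0)" using weak_primitive_exists by blast
  define A where "A = inner ?one (l2_class a)"
  have "a0 * (norm ?one)\<^sup>2 \<le> inner (l2_mult a ?one) ?one" by (rule inner_l2_mult_ge)
  also have "\<dots> = A" by (simp add: A_def l2_mult_class inner_commute)
  finally have A: "0 < A" using a0_pos by simp
  define c where "c = (- inner (v 0) ?one - inner u0 (l2_class a)) / A"
  have "has_weak_deriv (u0 + c *\<^sub>R ?one) (- q 0 + c *\<^sub>R 0)"
    by (intro has_weak_deriv_add has_weak_deriv_scale u0 has_weak_deriv_const)
  moreover have "inner (u0 + c *\<^sub>R ?one) (l2_class a) = - inner (v 0) ?one"
    using A by (simp add: inner_add_left A_def[symmetric] c_def)
  ultimately show thesis using that[of "u0 + c *\<^sub>R ?one"] by simp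
qed

end

locale mild_damped_potential = mild_damped +
  fixes u0 :: l2
  assumes weak_u0: "has_weak_deriv u0 (- q 0)"
    and mean_u0: "inner u0 (l2_class a) = - inner (v 0) (l2_class (\<lambda>x. 1))"
begin

definition U :: "real \<Rightarrow> l2" where
  "U t = u0 + Z1 t"

lemma weak_U:
  assumes "t \<in> {0..T}"
  shows "has_weak_deriv (U t) (- q t)"
proof -
  have "has_weak_deriv (U t) (- q 0 + w1 t)"
    unfolding U_def by (intro has_weak_deriv_add weak_u0 weak_Z1 assms)
  then show ?thesis using eq_q[OF assms] by simp
qed

text \<open>Pairing the integrated equation for \<open>v\<close> with the constant one removes
  \<open>r2 t\<close>, because a constant has derivative zero. The damping term becomes the pairing
  of \<open>Z1 t\<close> with \<open>a\<close>, so the condition imposed on \<open>u0\<close>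
  persists for all times.\<close>

lemma mean_U:
  assumes "t \<in> {0..T}"
  shows "inner (U t) (l2_class a) = - inner (v t) (l2_class (\<lambda>x. 1))"
proof -
  let ?one = "l2_class (\<lambda>x. 1)"
  have "inner ?one (r2 t) = - inner 0 (Z2 t)"
    by (rule H10_deriv_inner[OF weak_Z2[OF assms] has_weak_deriv_const])
  then have r2: "inner (r2 t) ?one = 0" by (simp add: inner_commute)
  have "inner (l2_mult a (Z1 t)) ?one = inner (Z1 t) (l2_class a)"
    by (simp add: inner_l2_mult_commute l2_mult_class)
  then show ?thesis
    unfolding eq_v[OF assms] U_def using mean_u0 r2 by (simp add: inner_add_left inner_diff_left)
qed

text \<open>The weighted Poincare inequality with \<open>b\<close> equal to \<open>a\<close> divided
  by its integral \<open>A\<close>. The weighted mean of \<open>U t\<close> is then minus the mean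
  of \<open>v t\<close> divided by \<open>A\<close>, and \<open>A\<close> is at least
  \<open>a0\<close>.\<close>

lemma norm_U_le:
  assumes "t \<in> {0..T}"
  shows "norm (U t) \<le> norm (q t) + norm (v t) / a0"
proof -
  let ?one = "l2_class (\<lambda>x. 1)"
  define A where "A = (LINT x|unit_leb. a x)"
  have "a0 * (norm ?one)\<^sup>2 \<le> inner (l2_mult a ?one) ?one" by (rule inner_l2_mult_ge)
  also have "\<dots> = A" by (simp add: A_def l2_mult_class inner_l2_one sq_integrable_a)
  finally have A: "a0 \<le> A" by simp
  then have A_pos: "0 < A" using a0_pos by simp
  define b where "b x = (1 / A) * a x" for x
  have b: "l2_class b = (1 / A) *\<^sub>R l2_class a"
    unfolding b_def by (rule l2_class_scale[symmetric]) (rule sq_integrable_a)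
  have "norm (U t - inner (U t) (l2_class b) *\<^sub>R ?one) \<le> norm (- q t)"
  proof (rule weighted_Poincare[OF weak_U[OF assms]])
    show "sq_integrable b" unfolding b_def by (intro sq_integrable_scale sq_integrable_a)
    show "0 \<le> b x" if "0 < x" "x < 1" for x
      using a_bounds[OF that] a0_pos A_pos by (simp add: b_def)
    show "(LINT x|unit_leb. b x) = 1"
      using A_pos by (simp add: b_def A_def[symmetric])
  qed
  moreover have "norm (inner (U t) (l2_class b) *\<^sub>R ?one) \<le> norm (v t) / a0"
  proof -
    have "\<bar>inner (v t) ?one\<bar> \<le> norm (v t)" using Cauchy_Schwarz_ineq2[of "v t" ?one] by simp
    then have "\<bar>inner (v t) ?one\<bar> / A \<le> norm (v t) / a0"
      using A a0_pos by (intro frac_le) auto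
    then show ?thesis using A_pos by (simp add: b mean_U[OF assms])
  qed
  ultimately show ?thesis
    using norm_triangle_ineq[of "U t - inner (U t) (l2_class b) *\<^sub>R ?one" "inner (U t) (l2_class b) *\<^sub>R ?one"]
    by simp
qed

lemma deriv_U:
  assumes "t \<in> {0..T}"
  shows "(U has_vector_derivative v t) (at t within {0..T})"
  unfolding U_def[abs_def] using has_vector_derivative_add[OF has_vector_derivative_const deriv_Z1[OF assms]]
  by simp

lemma continuous_U: "continuous_on {0..T} U"
  unfolding continuous_on_eq_continuous_within using deriv_U has_vector_derivative_continuous by blast

text \<open>\<open>v\<close> itself need not be differentiable, but its increments are weak derivatives of elements of
  \<open>H1_0\<close>, up to a damping term, and the derivative can be moved onto \<open>U\<close>.\<close>

lemma cross_derivative: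
  assumes t: "t \<in> {0..T}"
  shows "((\<lambda>s. inner (v s) (U s)) has_real_derivative
    (norm (v t))\<^sup>2 - (norm (q t))\<^sup>2 - inner (l2_mult a (v t)) (U t)) (at t within {0..T})"
  unfolding has_field_derivative_iff
proof -
  let ?d = "\<lambda>f s. (1 / (s - t)) *\<^sub>R (f s - f t)"
  have eq: "(inner (v s) (U s) - inner (v t) (U t)) / (s - t)
      = - inner (q s) (?d Z2 s) - inner (l2_mult a (?d Z1 s)) (U s) + inner (v t) (?d U s)"
    if s: "s \<in> {0..T}" for s
  proof -
    have "v s - v t = - (r2 s - r2 t) - l2_mult a (Z1 s - Z1 t)"
      using eq_v[OF s] eq_v[OF t] by (simp add: l2_mult_diff)
    \<comment> \<open>The increment of \<open>v\<close> is paired with \<open>U s\<close> and the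
      increment of \<open>U\<close> with \<open>v t\<close>, so only continuity of \<open>q\<close>
      and \<open>U\<close> enters the limit.\<close>
    moreover have "inner (r2 s - r2 t) (U s) = inner (q s) (Z2 s - Z2 t)"
      using H10_deriv_increment_inner[OF s t weak_U[OF s]] by simp
    moreover have "inner (v s) (U s) - inner (v t) (U t)
        = inner (v s - v t) (U s) + inner (v t) (U s - U t)"
      by (simp add: inner_diff_left inner_diff_right)
    ultimately have "inner (v s) (U s) - inner (v t) (U t)
        = - inner (q s) (Z2 s - Z2 t) - inner (l2_mult a (Z1 s - Z1 t)) (U s) + inner (v t) (U s - U t)"
      by (simp only: inner_diff_left[of "- _"] inner_minus_left)
    then show ?thesis
      by (simp only: l2_mult_scale inner_scaleR_left inner_scaleR_right)
        (simp add: diff_divide_distrib add_divide_distrib)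
  qed
  have within: "(f \<longlongrightarrow> f t) (at t within {0..T})" if "continuous_on {0..T} f" for f :: "real \<Rightarrow> l2"
    using that t by (simp add: continuous_on)
  have "((\<lambda>s. - inner (q s) (?d Z2 s) - inner (l2_mult a (?d Z1 s)) (U s) + inner (v t) (?d U s))
      \<longlongrightarrow> - inner (q t) (q t) - inner (l2_mult a (v t)) (U t) + inner (v t) (v t)) (at t within {0..T})"
    by (intro tendsto_intros bounded_linear.tendsto[OF bounded_linear_l2_mult]
        has_vector_derivative_quotient_tendsto deriv_Z1 deriv_Z2 deriv_U t within cont_q continuous_U)
  moreover have "- inner (q t) (q t) - inner (l2_mult a (v t)) (U t) + inner (v t) (v t)
      = (norm (v t))\<^sup>2 - (norm (q t))\<^sup>2 - inner (l2_mult a (v t)) (U t)"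
    by (simp add: power2_norm_eq_inner)
  moreover have "\<forall>\<^sub>F s in at t within {0..T}.
      - inner (q s) (?d Z2 s) - inner (l2_mult a (?d Z1 s)) (U s) + inner (v t) (?d U s)
      = (inner (v s) (U s) - inner (v t) (U t)) / (s - t)"
    unfolding eventually_at_filter by (intro always_eventually allI impI eq[symmetric])
  ultimately show "((\<lambda>s. (inner (v s) (U s) - inner (v t) (U t)) / (s - t)) \<longlongrightarrow>
      (norm (v t))\<^sup>2 - (norm (q t))\<^sup>2 - inner (l2_mult a (v t)) (U t)) (at t within {0..T})"
    using Lim_transform_eventually by (simp only:)
qed

definition lyapunov :: "real \<Rightarrow> real" where
  "lyapunov t = sq_norm t / 2 + rate * inner (v t) (U t)"

text \<open>Equivalently, \<open>lyapunov t\<close> lies between one quarter and three quarters of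
  \<open>sq_norm t\<close>.\<close>

lemma lyapunov_equivalent:
  assumes "t \<in> {0..T}"
  shows "\<bar>lyapunov t - sq_norm t / 2\<bar> \<le> sq_norm t / 4"
proof -
  have "\<bar>inner (v t) (U t)\<bar> \<le> norm (v t) * norm (U t)" by (rule Cauchy_Schwarz_ineq2)
  also have "\<dots> \<le> norm (v t) * (norm (q t) + norm (v t) / a0)"
    by (intro mult_left_mono norm_U_le assms) simp
  finally have "rate * \<bar>inner (v t) (U t)\<bar> \<le> rate * (norm (v t) * (norm (q t) + norm (v t) / a0))"
    using rate_pos by (intro mult_left_mono) auto
  also have "\<dots> \<le> sq_norm t / 4"
    unfolding sq_norm_def by (intro cross_term_le) auto
  finally show ?thesis using rate_pos by (simp add: lyapunov_def abs_mult)
qed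

lemma lyapunov_derivative:
  assumes t: "t \<in> {0..T}"
  obtains d where "(lyapunov has_real_derivative d) (at t within {0..T})"
    "d \<le> - (2 / 3 * rate) * lyapunov t"
proof
  let ?X = "(norm (v t))\<^sup>2 - (norm (q t))\<^sup>2 - inner (l2_mult a (v t)) (U t)"
  show "(lyapunov has_real_derivative - 2 * dissipation t / 2 + rate * ?X) (at t within {0..T})"
    unfolding lyapunov_def[abs_def]
    by (intro DERIV_add DERIV_cdivide DERIV_cmult energy_derivative cross_derivative t)
  have "\<bar>inner (l2_mult a (v t)) (U t)\<bar> \<le> norm (l2_mult a (v t)) * norm (U t)"
    by (rule Cauchy_Schwarz_ineq2)
  also have "\<dots> \<le> (a1 * norm (v t)) * (norm (q t) + norm (v t) / a0)"
    using a1_pos by (intro mult_mono norm_l2_mult_le norm_U_le t) auto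
  finally have "?X \<le> (norm (v t))\<^sup>2 - (norm (q t))\<^sup>2 + a1 * (norm (v t) * (norm (q t) + norm (v t) / a0))"
    by (simp add: mult.assoc)
  then have "rate * ?X \<le> rate * ((norm (v t))\<^sup>2 - (norm (q t))\<^sup>2 + a1 * (norm (v t) * (norm (q t) + norm (v t) / a0)))"
    using rate_pos by (intro mult_left_mono) auto
  moreover have "a0 * (norm (v t))\<^sup>2 \<le> dissipation t"
    unfolding dissipation_def by (rule inner_l2_mult_ge)
  note dissipation_rate_le[OF this, of "norm (q t)"]
  ultimately have "- 2 * dissipation t / 2 + rate * ?X \<le> - rate * (sq_norm t / 2)"
    unfolding sq_norm_def by linarith
  \<comment> \<open>The factor \<open>2 / 3\<close> converts half of \<open>sq_norm\<close> into the
    functional, which is at most \<open>3 / 4\<close> of it.\<close>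
  also have "\<dots> \<le> - (2 / 3 * rate) * lyapunov t"
  proof -
    have "lyapunov t \<le> 3 / 4 * sq_norm t" using lyapunov_equivalent[OF t] by linarith
    from mult_left_mono[OF this, of "2 / 3 * rate"] show ?thesis using rate_pos by simp
  qed
  finally show "- 2 * dissipation t / 2 + rate * ?X \<le> - (2 / 3 * rate) * lyapunov t" .
qed

text \<open>The differential inequality makes the functional times
  \<open>exp (2 / 3 * rate * t)\<close> nonincreasing; the two-sided comparison with
  \<open>sq_norm\<close> then costs the factor 3.\<close>

lemma sq_norm_decay:
  assumes st: "0 \<le> s" "s \<le> t" "t \<le> T"
  shows "sq_norm t \<le> 3 * exp (- (2 / 3 * rate) * (t - s)) * sq_norm s"
proof -
  let ?\<alpha> = "2 / 3 * rate"
  have "exp (?\<alpha> * t) * lyapunov t \<le> exp (?\<alpha> * s) * lyapunov s"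
  \<comment> \<open>Strictly between \<open>s\<close> and \<open>t\<close> the derivative within
    \<open>{0..T}\<close> is two-sided; at the ends only continuity is used.\<close>
  proof (rule DERIV_nonpos_imp_decreasing_open[OF st(2)])
    fix x assume x: "s < x" "x < t"
    then have xT: "x \<in> {0..T}" and int: "x \<in> interior {0..T}" using st by auto
    obtain d where d: "(lyapunov has_real_derivative d) (at x within {0..T})" "d \<le> - ?\<alpha> * lyapunov x"
      using lyapunov_derivative[OF xT] by blast
    have "(lyapunov has_real_derivative d) (at x)" using d(1) at_within_interior[OF int] by simp
    then have "((\<lambda>x. exp (?\<alpha> * x) * lyapunov x) has_real_derivative
        exp (?\<alpha> * x) * (?\<alpha> * lyapunov x + d)) (at x)"
      by (auto intro!: derivative_eq_intros simp: algebra_simps)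
    moreover have "exp (?\<alpha> * x) * (?\<alpha> * lyapunov x + d) \<le> 0"
      using d(2) by (intro mult_nonneg_nonpos) auto
    ultimately show "\<exists>y. ((\<lambda>x. exp (?\<alpha> * x) * lyapunov x) has_real_derivative y) (at x) \<and> y \<le> 0"
      by blast
  next
    have "continuous_on {0..T} lyapunov"
      unfolding lyapunov_def[abs_def] by (intro continuous_intros continuous_sq_norm cont_v continuous_U) simp
    then have "continuous_on {s..t} lyapunov" by (rule continuous_on_subset) (use st in auto)
    then show "continuous_on {s..t} (\<lambda>x. exp (?\<alpha> * x) * lyapunov x)" by (intro continuous_intros)
  qed
  then have *: "exp (- ?\<alpha> * t) * (exp (?\<alpha> * t) * lyapunov t) \<le> exp (- ?\<alpha> * t) * (exp (?\<alpha> * s) * lyapunov s)"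
    by (intro mult_left_mono) auto
  then have L: "lyapunov t \<le> exp (- ?\<alpha> * (t - s)) * lyapunov s"
  proof -
    have "exp (- ?\<alpha> * t) * (exp (?\<alpha> * r) * y) = exp (- ?\<alpha> * (t - r)) * y" for r y
    proof -
      have "- ?\<alpha> * t + ?\<alpha> * r = - ?\<alpha> * (t - r)" by (simp add: field_simps)
      then show ?thesis by (simp only: mult.assoc[symmetric] exp_add[symmetric])
    qed
    then have "exp (- ?\<alpha> * (t - t)) * lyapunov t \<le> exp (- ?\<alpha> * (t - s)) * lyapunov s"
      using * by (simp only:)
    then show ?thesis by simp
  qed
  have "t \<in> {0..T}" "s \<in> {0..T}" using st by auto
  then have bounds: "sq_norm t / 4 \<le> lyapunov t" "lyapunov s \<le> 3 / 4 * sq_norm s"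
    using lyapunov_equivalent[of t] lyapunov_equivalent[of s] by linarith+
  note bounds(1)
  also note L
  also have "exp (- ?\<alpha> * (t - s)) * lyapunov s \<le> exp (- ?\<alpha> * (t - s)) * (3 / 4 * sq_norm s)"
    using bounds(2) by (intro mult_left_mono) auto
  finally have "sq_norm t / 4 \<le> exp (- ?\<alpha> * (t - s)) * (3 / 4 * sq_norm s)" .
  then show ?thesis by (simp only: times_divide_eq_left times_divide_eq_right mult.left_commute[of _ 3])
qed

end

lemma (in damping) mild_solution_decay:
  assumes T: "0 < T" and mild: "mild_solution a T v q" and st: "0 \<le> s" "s \<le> t" "t \<le> T"
  shows "(norm (v t))\<^sup>2 + (norm (q t))\<^sup>2
    \<le> 3 * exp (- (2 / 3 * rate) * (t - s)) * ((norm (v s))\<^sup>2 + (norm (q s))\<^sup>2)"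
proof -
  have cont: "continuous_on {0..T} (\<lambda>t. (v t, q t))"
    using mild unfolding mild_solution_def by blast
  have "\<forall>t\<in>{0..T}. \<exists>Z. ((\<lambda>s. (v s, q s)) has_integral Z) {0..t} \<and> Z \<in> gen_dom \<and>
        (v t, q t) = (v 0, q 0) + gen a Z"
    using mild unfolding mild_solution_def by blast
  from bchoice[OF this] obtain Z where int: "\<And>t. t \<in> {0..T} \<Longrightarrow> ((\<lambda>s. (v s, q s)) has_integral Z t) {0..t}"
    and dom: "\<And>t. t \<in> {0..T} \<Longrightarrow> Z t \<in> gen_dom"
    and eq: "\<And>t. t \<in> {0..T} \<Longrightarrow> (v t, q t) = (v 0, q 0) + gen a (Z t)"
    by blast
  have der: "(Z has_vector_derivative (v t, q t)) (at t within {0..T})" if "t \<in> {0..T}" for t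
    using cont int that by (rule has_vector_derivative_of_integrals)
  interpret mild_damped a a0 a1 T v q "\<lambda>t. fst (Z t)" "\<lambda>t. snd (Z t)"
    "\<lambda>t. weak_deriv (fst (Z t))" "\<lambda>t. weak_deriv (snd (Z t))"
  proof
    show "0 < T" by (rule T)
    show "continuous_on {0..T} v" "continuous_on {0..T} q"
      using continuous_on_fst[OF cont] continuous_on_snd[OF cont] by simp_all
    fix t assume t: "t \<in> {0..T}"
    show "((\<lambda>t. fst (Z t)) has_vector_derivative v t) (at t within {0..T})"
      "((\<lambda>t. snd (Z t)) has_vector_derivative q t) (at t within {0..T})"
      using bounded_linear.has_vector_derivative[OF bounded_linear_fst der[OF t]]
        bounded_linear.has_vector_derivative[OF bounded_linear_snd der[OF t]] by simp_all
    show "has_weak_deriv (fst (Z t)) (weak_deriv (fst (Z t)))"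
      "H10_deriv (snd (Z t)) (weak_deriv (snd (Z t)))"
      using dom[OF t] by (auto simp: gen_dom_def weak_deriv_H1 weak_deriv_H1_0)
    show "v t = v 0 - weak_deriv (snd (Z t)) - l2_mult a (fst (Z t))"
      "q t = q 0 - weak_deriv (fst (Z t))"
      using eq[OF t] by (auto simp: gen_def split: prod.splits)
  qed
  obtain u0 where "has_weak_deriv u0 (- q 0)" "inner u0 (l2_class a) = - inner (v 0) (l2_class (\<lambda>x. 1))"
    using stationary_potential_exists by blast
  then interpret mild_damped_potential a a0 a1 T v q "\<lambda>t. fst (Z t)" "\<lambda>t. snd (Z t)"
    "\<lambda>t. weak_deriv (fst (Z t))" "\<lambda>t. weak_deriv (snd (Z t))" u0
    by unfold_locales
  show ?thesis using sq_norm_decay[OF st] by (simp only: sq_norm_def)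
qed

theorem theorem3p3:
  fixes T a0 a1 s t :: real and k :: nat and a :: "real \<Rightarrow> real"
    and u p :: "real \<Rightarrow> l2"
  assumes "T > 0"
    and "a0 > 0" and "a1 > 0"
    and "a \<in> borel_measurable (lebesgue_on {0<..<1})"
    and "\<forall>x\<in>{0<..<1}. a0 \<le> a x \<and> a x \<le> a1"
    and "mild_solution a T u p"
    and "finite_energy a T k u p"
    and "0 \<le> s" and "s \<le> t" and "t \<le> T"
  shows "energy T k u p t
    \<le> 3 * exp (- (4 / 3 * (a0 ^ 3 / (8 * a0\<^sup>2 + 4 * a0\<^sup>2 * a1 + 2 * a0 * a1 + a1 ^ 4))) * (t - s))
        * energy T k u p s"
proof -
  interpret damping a a0 a1
  proof
    show "0 < a0" "a \<in> borel_measurable unit_leb" by (rule assms)+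
    show "a0 \<le> a x \<and> a x \<le> a1" if "0 < x" "x < 1" for x
      using bspec[OF assms(5), of x] that by simp
  qed
  have "mild_solution a T (time_deriv T k u) (time_deriv T k p)"
    using assms(7) unfolding finite_energy_def by blast
  note decay = mild_solution_decay[OF assms(1) this assms(8-10)]
  have "2 / 3 * rate = 4 / 3 * (a0 ^ 3 / (8 * a0\<^sup>2 + 4 * a0\<^sup>2 * a1 + 2 * a0 * a1 + a1 ^ 4))"
    unfolding rate_def by (simp only: times_divide_eq_right times_divide_eq_left mult.assoc[symmetric])
  from mult_left_mono[OF decay[unfolded this], of "1 / 2"] show ?thesis
    unfolding energy_def by (simp only: mult.left_commute[of "1 / 2"])
qed

end
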